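(* Let $N\ge2$, $\omega>0$, and let $A_0,A_3,B_0,D_0,D_2,F_0,F_1,F_2,F_4,G_0,G_1,G_3$ be arbitrary complex constants. Each of the following six Newtonian $N$-body systems (with $n=1,\dots,N$) is isochronous, in the sense that there is a positive integer $p$, independent of the initial data, such that every solution $(z_1(t),\dots,z_N(t))$ defined, with pairwise distinct coordinates, for all $t\in\mathbb R$ satisfies $z_n(t+2\pi p/\omega)=z_n(t)$ for all $t\in\mathbb{R}$ and $n=1,\dots,N$. (1) $$\ddot z_n+3i\omega\dot z_n-2\omega^2z_n=B_0+2\sum_{\ell\ne n}\frac{(\dot z_n+2i\omega z_n)(\dot z_\ell+2i\omega z_\ell)}{z_n-z_\ell}+\sum_{k,\ell}{}^{(n)}\frac{3F_2z_n^2}{(z_n-z_\ell)(z_n-z_k)}.$$ (2) $$\ddot z_n+i\omega\dot z_n=\sum_{\ell\ne n}\frac{2(\dot z_n+i\omega z_n)(\dot z_\ell+i\omega z_\ell)+2A_0-D_0[\dot z_n+\dot z_\ell+i\omega(z_n+z_\ell)]}{z_n-z_\ell}$$ $$+\sum_{k,\ell}{}^{(n)}\bigg[\frac{3F_1z_n}{(z_n-z_\ell)(z_n-z_k)}-\frac{G_1z_n}{z_n-z_\ell}\Big(\frac{\dot z_n+\dot z_k+i\omega(z_n+z_k)}{z_n-z_k}+\frac{\dot z_\ell+\dot z_k+i\omega(z_\ell+z_k)}{z_\ell-z_k}\Big)\bigg].$$ (3) $$\ddot z_n+\frac{i\omega}{3}\dot z_n+\frac29\omega^2z_n=2\sum_{\ell\ne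 n}\frac{(\dot z_n+2i\omega z_n/3)(\dot z_\ell+2i\omega z_\ell/3)}{z_n-z_\ell}+\sum_{k,\ell}{}^{(n)}\frac{3F_0}{(z_n-z_\ell)(z_n-z_k)}.$$ (4) $$\ddot z_n+\frac{\omega^2}{4}z_n=2\sum_{\ell\ne n}\frac{(\dot z_n+i\omega z_n/2)(\dot z_\ell+i\omega z_\ell/2)}{z_n-z_\ell}$$ $$-\sum_{k,\ell}{}^{(n)}\frac{G_0}{z_n-z_\ell}\Big(\frac{\dot z_n+\dot z_k+i\omega(z_n+z_k)/2}{z_n-z_k}+\frac{\dot z_\ell+\dot z_k+i\omega(z_\ell+z_k)/2}{z_\ell-z_k}\Big).$$ (5) $$\ddot z_n-3i\omega\dot z_n-2\omega^2z_n=(N-1)(N-2)G_3(\dot z_n-i\omega z_n)z_n$$ $$+\sum_{\ell\ne n}\frac{2(\dot z_n-i\omega z_n)(\dot z_\ell-i\omega z_\ell)-D_2z_n[(\dot z_n-i\omega z_n)z_\ell+(\dot z_\ell-i\omega z_\ell)z_n]}{z_n-z_\ell}$$ $$-\sum_{k,\ell}{}^{(n)}\frac{G_3z_n^3}{z_n-z_\ell}\Big(\frac{\dot z_n+\dot z_k-i\omega(z_n+z_k)}{z_n-z_k}+\frac{\dot z_\ell+\dot z_k-i\omega(z_\ell+z_k)}{z_\ell-z_k}\Big).$$ (6) $$\ddot z_n-5i\omega\dot z_n-6\omega^2z_n=-(N-1)[2A_3+3(N-2)F_4]z_n^2$$ $$+\sum_{\ell\ne n}\frac{2(\dot z_n-2i\omega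 z_n)(\dot z_\ell-2i\omega z_\ell)+2A_3z_n^3}{z_n-z_\ell}+\sum_{k,\ell}{}^{(n)}\frac{3F_4z_n^4}{(z_n-z_\ell)(z_n-z_k)}.$$
   Context: The $z_n(t)$ are complex-valued functions of real $t$, dots denote $d/dt$, and $i^2=-1$. $\sum_{\ell\ne n}$ denotes the sum over $\ell\in\{1,\dots,N\}$ with $\ell\neq n$; $\sum_{k,\ell}^{(n)}$ denotes the sum over $k,\ell\in\{1,\dots,N\}$ with $k\ne n$, $\ell\ne n$, $k\ne\ell$. Empty sums are zero. *)

theory Defs
  imports "HOL-Analysis.Analysis"
begin

(* A second-order system is given by its n-th equation, as a relation between the
   positions z, velocities v and accelerations a at one instant, and the particle index n. *)
type_synonym second_order_system =
  "(nat \<Rightarrow> complex) \<Rightarrow> (nat \<Rightarrow> complex) \<Rightarrow> (nat \<Rightarrow> complex) \<Rightarrow> nat \<Rightarrow> bool"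

definition global_solution ::
  "nat \<Rightarrow> second_order_system \<Rightarrow> (nat \<Rightarrow> real \<Rightarrow> complex) \<Rightarrow> bool" where
  "global_solution N S z \<longleftrightarrow>
     (\<exists>v a. \<forall>t.
        inj_on (\<lambda>n. z n t) {1..N} \<and>
        (\<forall>n\<in>{1..N}.
           (z n has_vector_derivative v n t) (at t) \<and>
           (v n has_vector_derivative a n t) (at t) \<and>
           S (\<lambda>m. z m t) (\<lambda>m. v m t) (\<lambda>m. a m t) n))"

definition isochronous :: "nat \<Rightarrow> real \<Rightarrow> second_order_system \<Rightarrow> bool" where
  "isochronous N \<omega> S \<longleftrightarrow>
     (\<exists>p::nat. p > 0 \<and>
        (\<forall>z. global_solution N S z \<longrightarrow>
           (\<forall>t. \<forall>n\<in>{1..N}. z n (t + 2 * pi * real p / \<omega>) = z n t)))"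

definition others :: "nat \<Rightarrow> nat \<Rightarrow> nat set" where
  "others N n = {l \<in> {1..N}. l \<noteq> n}"

definition other_pairs :: "nat \<Rightarrow> nat \<Rightarrow> (nat \<times> nat) set" where
  "other_pairs N n = {(k, l). k \<in> {1..N} \<and> l \<in> {1..N} \<and> k \<noteq> n \<and> l \<noteq> n \<and> k \<noteq> l}"

definition system1 :: "nat \<Rightarrow> real \<Rightarrow> complex \<Rightarrow> complex \<Rightarrow> second_order_system" where
  "system1 N \<omega> B0 F2 z v a n \<longleftrightarrow>
     a n + 3 * \<i> * of_real \<omega> * v n - 2 * (of_real \<omega>)^2 * z n =
       B0
       + 2 * (\<Sum>l\<in>others N n.
           (v n + 2 * \<i> * of_real \<omega> * z n) * (v l + 2 * \<i> * of_real \<omega> * z l) / (z n - z l))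
       + (\<Sum>(k, l)\<in>other_pairs N n. 3 * F2 * (z n)^2 / ((z n - z l) * (z n - z k)))"

definition system2 ::
  "nat \<Rightarrow> real \<Rightarrow> complex \<Rightarrow> complex \<Rightarrow> complex \<Rightarrow> complex \<Rightarrow> second_order_system" where
  "system2 N \<omega> A0 D0 F1 G1 z v a n \<longleftrightarrow>
     a n + \<i> * of_real \<omega> * v n =
       (\<Sum>l\<in>others N n.
           (2 * (v n + \<i> * of_real \<omega> * z n) * (v l + \<i> * of_real \<omega> * z l) + 2 * A0
             - D0 * (v n + v l + \<i> * of_real \<omega> * (z n + z l))) / (z n - z l))
       + (\<Sum>(k, l)\<in>other_pairs N n.
           3 * F1 * z n / ((z n - z l) * (z n - z k))
           - G1 * z n / (z n - z l) *
               ((v n + v k + \<i> * of_real \<omega> * (z n + z k)) / (z n - z k)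
                + (v l + v k + \<i> * of_real \<omega> * (z l + z k)) / (z l - z k)))"

definition system3 :: "nat \<Rightarrow> real \<Rightarrow> complex \<Rightarrow> second_order_system" where
  "system3 N \<omega> F0 z v a n \<longleftrightarrow>
     a n + \<i> * of_real \<omega> / 3 * v n + 2 / 9 * (of_real \<omega>)^2 * z n =
       2 * (\<Sum>l\<in>others N n.
           (v n + 2 * \<i> * of_real \<omega> * z n / 3) * (v l + 2 * \<i> * of_real \<omega> * z l / 3)
             / (z n - z l))
       + (\<Sum>(k, l)\<in>other_pairs N n. 3 * F0 / ((z n - z l) * (z n - z k)))"

definition system4 :: "nat \<Rightarrow> real \<Rightarrow> complex \<Rightarrow> second_order_system" where
  "system4 N \<omega> G0 z v a n \<longleftrightarrow>
     a n + (of_real \<omega>)^2 / 4 * z n =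
       2 * (\<Sum>l\<in>others N n.
           (v n + \<i> * of_real \<omega> * z n / 2) * (v l + \<i> * of_real \<omega> * z l / 2) / (z n - z l))
       - (\<Sum>(k, l)\<in>other_pairs N n.
           G0 / (z n - z l) *
             ((v n + v k + \<i> * of_real \<omega> * (z n + z k) / 2) / (z n - z k)
              + (v l + v k + \<i> * of_real \<omega> * (z l + z k) / 2) / (z l - z k)))"

definition system5 :: "nat \<Rightarrow> real \<Rightarrow> complex \<Rightarrow> complex \<Rightarrow> second_order_system" where
  "system5 N \<omega> D2 G3 z v a n \<longleftrightarrow>
     a n - 3 * \<i> * of_real \<omega> * v n - 2 * (of_real \<omega>)^2 * z n =
       (of_nat N - 1) * (of_nat N - 2) * G3 * (v n - \<i> * of_real \<omega> * z n) * z n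
       + (\<Sum>l\<in>others N n.
           (2 * (v n - \<i> * of_real \<omega> * z n) * (v l - \<i> * of_real \<omega> * z l)
             - D2 * z n * ((v n - \<i> * of_real \<omega> * z n) * z l
                           + (v l - \<i> * of_real \<omega> * z l) * z n)) / (z n - z l))
       - (\<Sum>(k, l)\<in>other_pairs N n.
           G3 * (z n)^3 / (z n - z l) *
             ((v n + v k - \<i> * of_real \<omega> * (z n + z k)) / (z n - z k)
              + (v l + v k - \<i> * of_real \<omega> * (z l + z k)) / (z l - z k)))"

definition system6 :: "nat \<Rightarrow> real \<Rightarrow> complex \<Rightarrow> complex \<Rightarrow> second_order_system" where
  "system6 N \<omega> A3 F4 z v a n \<longleftrightarrow>
     a n - 5 * \<i> * of_real \<omega> * v n - 6 * (of_real \<omega>)^2 * z n =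
       - ((of_nat N - 1) * (2 * A3 + 3 * (of_nat N - 2) * F4) * (z n)^2)
       + (\<Sum>l\<in>others N n.
           (2 * (v n - 2 * \<i> * of_real \<omega> * z n) * (v l - 2 * \<i> * of_real \<omega> * z l)
             + 2 * A3 * (z n)^3) / (z n - z l))
       + (\<Sum>(k, l)\<in>other_pairs N n. 3 * F4 * (z n)^4 / ((z n - z l) * (z n - z k)))"

end

(* Put x_n(t) = cis(-lam w t) z_n(t), where lam = -2, -1, -2/3, -1/2, 1, 2 for the six systems, and let
   tau be a complex time with dtau/dt = cis(w t).  In these variables every system becomes the autonomous
   one with w = 0.  For psi = prod_n (X - x_n) the latter says that psi_tautau plus a fixed linear
   differential operator in X, applied to psi and psi_tau, vanishes at the N distinct nodes x_n; the degree
   is below N, so the expression vanishes identically.  The operator strictly lowers (systems 1-4) or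
   strictly raises (systems 5, 6) the X-degree, so the coefficients of psi are obtained recursively by
   integration in tau and are polynomials in cis(w t), free of secular terms.  Hence psi has period
   2 pi / w.  As 6 lam is an integer, after 6 such periods the z_n are permuted among themselves; by
   continuity the permutation does not depend on t, and N! repetitions undo it. *)
theory Submission
  imports Defs
begin


section \<open>Polynomials in the exponential and periodicity\<close>

text \<open>The values of \<open>lam\<close> come from counting phases. Under the substitution an
  acceleration acquires the phase \<open>s * E^2\<close>, and a coupling whose operator is X^j
  (d/dX)^k (d/dtau)^r with r = 0 or 1 acquires \<open>s^(1 + j - k) * E^r\<close>. The two agree
  exactly when lam (j - k) = 2 - r, and each system groups couplings that share one value of lam:
  the letters B, A, F stand for r = 0 and k = 1, 2, 3, the letters D, G for r = 1 and k = 1, 2, and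
  the index is j. Since r < 2, the degree shift j - k is nonzero and has the sign of lam; this makes
  the recursion triangular. The term quadratic in the velocities is produced by the second
  tau-derivative of psi itself. Only nonnegative powers of \<open>cis (\<omega> * t)\<close> may
  occur: a power -1, multiplied by dtau/dt, would be constant and integrate to a linear function of
  t. The obstacle is that a raising operator could bring degree N into an expression that must stay
  below N. The N-dependent terms of \<open>system5\<close> and \<open>system6\<close>, and the form
  of the \<open>D2\<close> numerator, compensate for this.\<close>

definition cis_poly :: "real \<Rightarrow> (real \<Rightarrow> complex) \<Rightarrow> bool" where
  "cis_poly \<omega> f \<longleftrightarrow> (\<exists>p. \<forall>t. f t = poly p (cis (\<omega> * t)))"

lemma cis_poly_const [simp]: "cis_poly \<omega> (\<lambda>t. c)"
  unfolding cis_poly_def by (rule exI[of _ "[:c:]"]) simp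

lemma cis_poly_add:
  assumes "cis_poly \<omega> f" and "cis_poly \<omega> g"
  shows "cis_poly \<omega> (\<lambda>t. f t + g t)"
proof -
  obtain p q where "\<And>t. f t = poly p (cis (\<omega> * t))" "\<And>t. g t = poly q (cis (\<omega> * t))"
    using assms unfolding cis_poly_def by blast
  then have "f t + g t = poly (p + q) (cis (\<omega> * t))" for t
    by simp
  then show ?thesis
    unfolding cis_poly_def by blast
qed

lemma cis_poly_cmult:
  assumes "cis_poly \<omega> f"
  shows "cis_poly \<omega> (\<lambda>t. c * f t)"
proof -
  obtain p where "\<And>t. f t = poly p (cis (\<omega> * t))"
    using assms unfolding cis_poly_def by blast
  then have "c * f t = poly (smult c p) (cis (\<omega> * t))" for t
    by simp
  then show ?thesis
    unfolding cis_poly_def by blast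
qed

lemma cis_poly_minus: "cis_poly \<omega> f \<Longrightarrow> cis_poly \<omega> (\<lambda>t. - f t)"
  using cis_poly_cmult[of \<omega> f "-1"] by simp

lemma ex_pderiv_eq: "\<exists>q. pderiv q = (p :: complex poly)"
proof -
  let ?q = "\<Sum>i\<le>degree p. monom (coeff p i / of_nat (Suc i)) (Suc i)"
  have "pderiv ?q = (\<Sum>i\<le>degree p. monom (coeff p i) i)"
    using higher_pderiv_sum[of 1 "\<lambda>i. monom (coeff p i / of_nat (Suc i)) (Suc i)" "{..degree p}"]
    by (simp add: pderiv_monom del: of_nat_Suc)
  then have "pderiv ?q = p"
    by (simp only: poly_as_sum_of_monoms)
  then show ?thesis
    by (rule exI)
qed

lemma has_vector_derivative_cis_linear:
  "((\<lambda>t. cis (\<omega> * t)) has_vector_derivative \<i> * of_real \<omega> * cis (\<omega> * t)) (at t)"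
proof -
  have "((\<lambda>t. exp (t *\<^sub>R (\<i> * of_real \<omega>))) has_vector_derivative
          exp (t *\<^sub>R (\<i> * of_real \<omega>)) * (\<i> * of_real \<omega>)) (at t)"
    by (rule exp_scaleR_has_vector_derivative_right)
  then show ?thesis
    by (simp add: cis_conv_exp scaleR_conv_of_real mult_ac)
qed

text \<open>The factor \<open>cis (\<omega> * t)\<close> removes the constant term that would integrate to a secular term.\<close>

lemma cis_poly_antiderivative:
  assumes "\<omega> \<noteq> 0" and g: "cis_poly \<omega> g"
    and f: "\<And>t. (f has_vector_derivative cis (\<omega> * t) * g t) (at t)"
  shows "cis_poly \<omega> f"
proof -
  obtain p where p: "\<And>t. g t = poly p (cis (\<omega> * t))"
    using g unfolding cis_poly_def by blast
  \<comment> \<open>The chain rule contributes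
    \<open>\<i> * of_real \<omega> * cis (\<omega> * t)\<close>; dividing by the constant part
    leaves exactly the factor \<open>cis (\<omega> * t)\<close> of the hypothesis.\<close>
  obtain q where q: "pderiv q = smult (1 / (\<i> * of_real \<omega>)) p"
    using ex_pderiv_eq by blast
  let ?F = "\<lambda>t. poly q (cis (\<omega> * t))"
  have F: "(?F has_vector_derivative cis (\<omega> * t) * g t) (at t)" for t
  proof -
    have "(poly q has_field_derivative poly (pderiv q) (cis (\<omega> * t))) (at (cis (\<omega> * t)))"
      by (rule poly_DERIV)
    from field_vector_diff_chain_at[OF has_vector_derivative_cis_linear this]
    show ?thesis
      using \<open>\<omega> \<noteq> 0\<close> by (simp add: o_def q p field_simps)
  qed
  have "((\<lambda>t. f t - ?F t) has_derivative (\<lambda>h. 0)) (at t within UNIV)" for t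
    using has_vector_derivative_diff[OF f F] by (simp add: has_vector_derivative_def)
  then obtain c where "\<And>t. f t - ?F t = c"
    using has_derivative_zero_constant[of UNIV "\<lambda>t. f t - ?F t"] by auto
  then have "f t = poly (q + [:c:]) (cis (\<omega> * t))" for t
    by (simp add: algebra_simps)
  then show ?thesis
    unfolding cis_poly_def by blast
qed

lemma cis_poly_periodic:
  assumes "cis_poly \<omega> f" and "\<omega> > 0"
  shows "f (t + 2 * pi * real p / \<omega>) = f t"
proof -
  obtain q where q: "\<And>t. f t = poly q (cis (\<omega> * t))"
    using assms(1) unfolding cis_poly_def by blast
  have "\<omega> * (t + 2 * pi * real p / \<omega>) = \<omega> * t + 2 * pi * real p"
    using assms(2) by (simp add: field_simps)
  then have "cis (\<omega> * (t + 2 * pi * real p / \<omega>)) = cis (\<omega> * t) * cis (2 * pi * real p)"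
    by (simp only: cis_mult)
  also have "\<dots> = cis (\<omega> * t)"
    by (simp only: cis_multiple_2pi[OF Ints_of_nat] mult_1_right)
  finally show ?thesis
    by (simp only: q)
qed

section \<open>Polynomials depending on time, differentiated coefficientwise\<close>

text \<open>With \<open>E t\<close> as the speed of a complex time, \<open>f'\<close> is the
  derivative in that time. Working coefficient by coefficient suits the later recursion, which
  integrates one coefficient after another.\<close>

definition has_poly_derivative ::
  "(real \<Rightarrow> complex) \<Rightarrow> (real \<Rightarrow> complex poly) \<Rightarrow> (real \<Rightarrow> complex poly) \<Rightarrow> bool" where
  "has_poly_derivative E f f' \<longleftrightarrow>
     (\<forall>k t. ((\<lambda>t. coeff (f t) k) has_vector_derivative E t * coeff (f' t) k) (at t))"

lemma has_poly_derivative_0: "has_poly_derivative E (\<lambda>t. c) (\<lambda>t. 0)"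
  unfolding has_poly_derivative_def by auto

lemma has_poly_derivative_minus:
  "has_poly_derivative E f f' \<Longrightarrow> has_poly_derivative E (\<lambda>t. - f t) (\<lambda>t. - f' t)"
  unfolding has_poly_derivative_def coeff_minus mult_minus_right
  by (intro allI has_vector_derivative_minus) blast

lemma has_poly_derivative_sum:
  assumes "\<And>i. i \<in> J \<Longrightarrow> has_poly_derivative E (f i) (f' i)"
  shows "has_poly_derivative E (\<lambda>t. \<Sum>i\<in>J. f i t) (\<lambda>t. \<Sum>i\<in>J. f' i t)"
  using assms unfolding has_poly_derivative_def
  unfolding coeff_sum sum_distrib_left
  by (intro allI has_vector_derivative_sum) blast

lemma has_poly_derivative_mult:
  assumes "has_poly_derivative E f f'" and "has_poly_derivative E g g'"
  shows "has_poly_derivative E (\<lambda>t. f t * g t) (\<lambda>t. f t * g' t + f' t * g t)"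
  unfolding has_poly_derivative_def
proof (intro allI)
  fix k t
  have "((\<lambda>t. \<Sum>i\<le>k. coeff (f t) i * coeff (g t) (k - i)) has_vector_derivative
      (\<Sum>i\<le>k. coeff (f t) i * (E t * coeff (g' t) (k - i)) +
        E t * coeff (f' t) i * coeff (g t) (k - i))) (at t)"
    using assms unfolding has_poly_derivative_def
    by (intro has_vector_derivative_sum has_vector_derivative_mult) auto
  then show "((\<lambda>t. coeff (f t * g t) k) has_vector_derivative
      E t * coeff (f t * g' t + f' t * g t) k) (at t)"
    by (simp add: coeff_mult sum_distrib_left sum.distrib algebra_simps)
qed

text \<open>Serves the leading coefficients: a monic polynomial of constant degree N has derivatives
  of degree below N, with no need to expand the sums that define them.\<close>

lemma has_poly_derivative_coeff_const:
  assumes "\<And>t. E t \<noteq> 0" and "has_poly_derivative E f g" and "\<And>t. coeff (f t) k = c"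
  shows "coeff (g t) k = 0"
proof -
  have "((\<lambda>t. coeff (f t) k) has_vector_derivative E t * coeff (g t) k) (at t)"
    using assms(2) unfolding has_poly_derivative_def by blast
  then have "((\<lambda>t. c) has_vector_derivative E t * coeff (g t) k) (at t)"
    by (simp add: assms(3))
  then have "E t * coeff (g t) k = 0"
    using vector_derivative_unique_at has_vector_derivative_const by blast
  then show ?thesis
    using assms(1) by simp
qed

text \<open>Well-founded induction on a rank \<open>m\<close> of the coefficient indices, so that
  one argument covers recursions running down and up in degree. Each step integrates twice, from
  \<open>f''\<close> to \<open>f'\<close> and from \<open>f'\<close> to \<open>f\<close>.\<close>

lemma cis_poly_coeffs:
  fixes m :: "nat \<Rightarrow> nat"
  assumes "\<omega> \<noteq> 0"
    and D: "has_poly_derivative (\<lambda>t. cis (\<omega> * t)) f f'"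
           "has_poly_derivative (\<lambda>t. cis (\<omega> * t)) f' f''"
    and step: "\<And>k. (\<And>j. m j < m k \<Longrightarrow> cis_poly \<omega> (\<lambda>t. coeff (f t) j)) \<Longrightarrow>
                (\<And>j. m j < m k \<Longrightarrow> cis_poly \<omega> (\<lambda>t. coeff (f' t) j)) \<Longrightarrow>
                cis_poly \<omega> (\<lambda>t. coeff (f'' t) k)"
  shows "cis_poly \<omega> (\<lambda>t. coeff (f t) k)"
proof -
  have "cis_poly \<omega> (\<lambda>t. coeff (f t) k) \<and> cis_poly \<omega> (\<lambda>t. coeff (f' t) k)" for k
  proof (induction k rule: measure_induct_rule[of m])
    case (less k)
    have "cis_poly \<omega> (\<lambda>t. coeff (f'' t) k)"
      using less.IH by (intro step) auto
    then have *: "cis_poly \<omega> (\<lambda>t. coeff (f' t) k)"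
      using cis_poly_antiderivative[OF assms(1)] D(2) unfolding has_poly_derivative_def by blast
    then have "cis_poly \<omega> (\<lambda>t. coeff (f t) k)"
      using cis_poly_antiderivative[OF assms(1)] D(1) unfolding has_poly_derivative_def by blast
    with * show ?case by simp
  qed
  then show ?thesis by simp
qed

section \<open>From permuted branches to periodic functions\<close>

text \<open>The sets on which \<open>f\<close> follows a given branch are closed and partition the line.\<close>

lemma continuous_selection:
  fixes f :: "real \<Rightarrow> complex" and z :: "'i \<Rightarrow> real \<Rightarrow> complex"
  assumes "finite J" and f: "continuous_on UNIV f"
    and z: "\<And>m. m \<in> J \<Longrightarrow> continuous_on UNIV (z m)"
    and inj: "\<And>t. inj_on (\<lambda>m. z m t) J" and sel: "\<And>t. \<exists>m\<in>J. f t = z m t"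
  obtains m where "m \<in> J" and "\<And>t. f t = z m t"
proof -
  obtain m where m: "m \<in> J" "f 0 = z m 0"
    using sel by blast
  define S where "S l = {t. f t = z l t}" for l
  have closed: "closed (S l)" if "l \<in> J" for l
    unfolding S_def by (rule closed_Collect_eq[OF f z[OF that]])
  have "- S m = (\<Union>l\<in>J - {m}. S l)"
  proof (rule equalityI; rule subsetI)
    fix t assume "t \<in> - S m"
    moreover obtain l where "l \<in> J" "f t = z l t"
      using sel by blast
    ultimately show "t \<in> (\<Union>l\<in>J - {m}. S l)"
      unfolding S_def by blast
  next
    fix t assume "t \<in> (\<Union>l\<in>J - {m}. S l)"
    then obtain l where l: "l \<in> J" "l \<noteq> m" "f t = z l t"
      unfolding S_def by blast
    with inj_onD[OF inj, of l t m] m(1) show "t \<in> - S m"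
      unfolding S_def by auto
  qed
  then have "closed (- S m)"
    using closed \<open>finite J\<close> by (simp add: closed_UN)
  then have "open (S m)"
    by (simp only: open_closed)
  with closed[OF m(1)] have "S m = {} \<or> S m = UNIV"
    by (simp only: clopen[symmetric])
  moreover have "0 \<in> S m"
    using m(2) by (simp add: S_def)
  ultimately have "S m = UNIV"
    by blast
  then have *: "f t = z m t" for t
    by (simp add: S_def set_eq_iff)
  show ?thesis
    by (rule that[OF m(1)]) (rule *)
qed

text \<open>Each shift of \<open>z n\<close> by a multiple of T is one fixed branch for all t. Two
  of the first N + 1 shifts use the same branch, so \<open>z n\<close> has a period d T with 1 <= d
  <= N, and every such d divides N!.\<close>

lemma periodic_if_permuted:
  fixes z :: "nat \<Rightarrow> real \<Rightarrow> complex"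
  assumes cont: "\<And>n. n \<in> {1..N} \<Longrightarrow> continuous_on UNIV (z n)"
    and inj: "\<And>t. inj_on (\<lambda>m. z m t) {1..N}"
    and perm: "\<And>t n. n \<in> {1..N} \<Longrightarrow> \<exists>m\<in>{1..N}. z n (t + T) = z m t"
    and n: "n \<in> {1..N}"
  shows "z n (t + real (fact N) * T) = z n t"
proof -
  \<comment> \<open>Still pointwise in t: the index m may vary with t until
    \<open>continuous_selection\<close> is applied.\<close>
  have mult: "\<exists>m\<in>{1..N}. z n (t + real j * T) = z m t" for j t
  proof (induction j arbitrary: t)
    case 0
    show ?case
      by (rule bexI[OF _ n]) simp
  next
    case (Suc j)
    obtain m where "m \<in> {1..N}" "z n (t + T + real j * T) = z m (t + T)"
      using Suc by blast
    moreover have "t + T + real j * T = t + real (Suc j) * T"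
      by (simp add: distrib_right)
    ultimately show ?case
      using perm[of m t] by simp
  qed
  have "\<exists>m. m \<in> {1..N} \<and> (\<forall>t. z n (t + real j * T) = z m t)" for j
  proof -
    have "continuous_on UNIV (\<lambda>t. z n (t + real j * T))"
      by (rule continuous_on_compose2[OF cont[OF n]]) (intro continuous_intros, simp)
    then show ?thesis
    proof (rule continuous_selection[OF finite_atLeastAtMost _ cont inj mult])
      fix m assume "m \<in> {1..N}" and "\<And>t. z n (t + real j * T) = z m t"
      then show ?thesis
        by (intro exI[of _ m] conjI allI)
    qed
  qed
  then have "\<exists>\<sigma>. \<forall>j. \<sigma> j \<in> {1..N} \<and> (\<forall>t. z n (t + real j * T) = z (\<sigma> j) t)"
    by (intro choice allI)
  then obtain \<sigma> where "\<forall>j. \<sigma> j \<in> {1..N} \<and> (\<forall>t. z n (t + real j * T) = z (\<sigma> j) t)" ..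
  then have \<sigma>: "\<sigma> j \<in> {1..N}" "z n (t + real j * T) = z (\<sigma> j) t" for j t
    by simp_all
  \<comment> \<open>Pigeonhole: N + 1 shifts, N branches.\<close>
  have "\<not> inj_on \<sigma> {0..N}"
  proof
    assume "inj_on \<sigma> {0..N}"
    then have "card {0..N} \<le> card {1..N}"
      using \<sigma>(1) by (intro card_inj_on_le[of \<sigma>]) auto
    then show False by simp
  qed
  then obtain k l where kl: "k \<le> N" "l \<le> N" "k \<noteq> l" "\<sigma> k = \<sigma> l"
    by (auto simp: inj_on_def)
  define i j where "i = min k l" and "j = max k l"
  have ij: "i < j" "j \<le> N" "\<sigma> i = \<sigma> j"
    using kl by (auto simp: i_def j_def min_def max_def)
  define d where "d = j - i"
  \<comment> \<open>The shifts by i T and j T agree everywhere, so evaluating both at t - i T leaves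
    the difference of the shifts.\<close>
  have period: "z n (t + real d * T) = z n t" for t
    using \<sigma>(2)[of "t - real i * T" i] \<sigma>(2)[of "t - real i * T" j] ij
    by (simp add: d_def of_nat_diff algebra_simps)
  have "z n (t + real (r * d) * T) = z n t" for r
  proof (induction r)
    case (Suc r)
    have "t + real (Suc r * d) * T = t + real (r * d) * T + real d * T"
      by (simp add: algebra_simps)
    then show ?case
      by (simp only: Suc.IH period)
  qed simp
  moreover have "d dvd fact N"
    using ij unfolding d_def by (intro dvd_fact) auto
  then obtain r where "fact N = d * r"
    by (rule dvdE)
  then have "fact N = r * d"
    by (simp only: mult.commute)
  ultimately show ?thesis
    by (simp only:)
qed


section \<open>Polynomials with moving roots\<close>

definition linear_poly :: "complex \<Rightarrow> complex poly" where
  "linear_poly c = [:- c, 1:]"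

lemma poly_linear_poly [simp]: "poly (linear_poly c) y = y - c"
  by (simp add: linear_poly_def)

lemma pderiv_linear_poly [simp]: "pderiv (linear_poly c) = 1"
  by (simp add: linear_poly_def pderiv_pCons)

definition root_poly :: "'i set \<Rightarrow> ('i \<Rightarrow> complex) \<Rightarrow> complex poly" where
  "root_poly J x = (\<Prod>l\<in>J. linear_poly (x l))"

text \<open>First and second derivative of \<open>root_poly J x\<close> along a motion with velocities \<open>u\<close> and
  accelerations \<open>w\<close>.\<close>

definition root_poly_vel :: "'i set \<Rightarrow> ('i \<Rightarrow> complex) \<Rightarrow> ('i \<Rightarrow> complex) \<Rightarrow> complex poly" where
  "root_poly_vel J x u = - (\<Sum>l\<in>J. smult (u l) (root_poly (J - {l}) x))"

definition root_poly_acc ::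
  "'i set \<Rightarrow> ('i \<Rightarrow> complex) \<Rightarrow> ('i \<Rightarrow> complex) \<Rightarrow> ('i \<Rightarrow> complex) \<Rightarrow> complex poly" where
  "root_poly_acc J x u w =
     - (\<Sum>l\<in>J. smult (w l) (root_poly (J - {l}) x) + smult (u l) (root_poly_vel (J - {l}) x u))"

text \<open>Weighted partial fractions. Weight 1 and k = 1 give the logarithmic derivative of
  \<open>root_poly\<close> in X; weight u and k = 1 give minus its logarithmic derivative along the
  motion.\<close>

definition pole_sum :: "'i set \<Rightarrow> ('i \<Rightarrow> complex) \<Rightarrow> ('i \<Rightarrow> complex) \<Rightarrow> nat \<Rightarrow> complex \<Rightarrow> complex" where
  "pole_sum J x f k y = (\<Sum>l\<in>J. f l / (y - x l) ^ k)"

lemma root_poly_empty [simp]: "root_poly {} x = 1"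
  by (simp add: root_poly_def)

lemma root_poly_vel_empty [simp]: "root_poly_vel {} x u = 0"
  by (simp add: root_poly_vel_def)

lemma pole_sum_empty [simp]: "pole_sum {} x f k y = 0"
  by (simp add: pole_sum_def)

lemma pole_sum_insert:
  "finite J \<Longrightarrow> m \<notin> J \<Longrightarrow>
   pole_sum (insert m J) x f k y = f m * inverse (y - x m) ^ k + pole_sum J x f k y"
  by (simp add: pole_sum_def divide_inverse power_inverse)

lemma root_poly_insert:
  "finite J \<Longrightarrow> m \<notin> J \<Longrightarrow> root_poly (insert m J) x = linear_poly (x m) * root_poly J x"
  unfolding root_poly_def by (subst prod.insert) auto

text \<open>Leibniz rule for \<open>linear_poly (x m) * root_poly J x\<close>; the new factor itself
  moves with velocity \<open>- u m\<close>.\<close>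

lemma root_poly_vel_insert:
  assumes "finite J" and "m \<notin> J"
  shows "root_poly_vel (insert m J) x u =
    linear_poly (x m) * root_poly_vel J x u - smult (u m) (root_poly J x)"
proof -
  have "(\<Sum>l\<in>J. smult (u l) (root_poly (insert m J - {l}) x)) =
      (\<Sum>l\<in>J. linear_poly (x m) * smult (u l) (root_poly (J - {l}) x))"
  proof (intro sum.cong refl)
    fix l assume "l \<in> J"
    then have "insert m J - {l} = insert m (J - {l})" "finite (J - {l})" "m \<notin> J - {l}"
      using assms by auto
    then show "smult (u l) (root_poly (insert m J - {l}) x) =
        linear_poly (x m) * smult (u l) (root_poly (J - {l}) x)"
      by (simp add: root_poly_insert)
  qed
  moreover have "insert m J - {m} = J"
    using assms by auto
  ultimately show ?thesis
    unfolding root_poly_vel_def sum.insert[OF assms] by (simp add: sum_distrib_left)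
qed

lemma smult_sum_right: "smult c (\<Sum>i\<in>J. f i) = (\<Sum>i\<in>J. smult c (f i))"
  by (induction J rule: infinite_finite_induct) (simp_all add: smult_add_right)

text \<open>Second-order Leibniz rule. The factor 2 collects two equal mixed terms: one from the
  summand l = m, the other from the m-part of \<open>root_poly_vel\<close> in the remaining
  summands.\<close>

lemma root_poly_acc_insert:
  assumes "finite J" and "m \<notin> J"
  shows "root_poly_acc (insert m J) x u w =
    linear_poly (x m) * root_poly_acc J x u w - smult (2 * u m) (root_poly_vel J x u)
      - smult (w m) (root_poly J x)"
proof -
  let ?L = "linear_poly (x m)"
  have "(\<Sum>l\<in>J. smult (w l) (root_poly (insert m J - {l}) x) +
        smult (u l) (root_poly_vel (insert m J - {l}) x u)) =
      (\<Sum>l\<in>J. ?L * (smult (w l) (root_poly (J - {l}) x) + smult (u l) (root_poly_vel (J - {l}) x u))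
        - smult (u m) (smult (u l) (root_poly (J - {l}) x)))"
  proof (intro sum.cong refl)
    fix l assume "l \<in> J"
    then have "insert m J - {l} = insert m (J - {l})" "finite (J - {l})" "m \<notin> J - {l}"
      using assms by auto
    then show "smult (w l) (root_poly (insert m J - {l}) x) +
        smult (u l) (root_poly_vel (insert m J - {l}) x u) =
        ?L * (smult (w l) (root_poly (J - {l}) x) + smult (u l) (root_poly_vel (J - {l}) x u))
        - smult (u m) (smult (u l) (root_poly (J - {l}) x))"
      by (simp add: root_poly_insert root_poly_vel_insert distrib_left
          smult_diff_right mult.commute[of "u m"])
  qed
  also have "\<dots> = - (?L * root_poly_acc J x u w) + smult (u m) (root_poly_vel J x u)"
    unfolding sum_subtractf sum_distrib_left[symmetric] root_poly_acc_def root_poly_vel_def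
    by (simp add: smult_sum_right)
  finally have *: "(\<Sum>l\<in>J. smult (w l) (root_poly (insert m J - {l}) x) +
        smult (u l) (root_poly_vel (insert m J - {l}) x u)) =
      - (?L * root_poly_acc J x u w) + smult (u m) (root_poly_vel J x u)" .
  have "insert m J - {m} = J"
    using assms by auto
  moreover have "smult (2 * u m) (root_poly_vel J x u) =
      smult (u m) (root_poly_vel J x u) + smult (u m) (root_poly_vel J x u)"
    by (simp only: smult_add_left[symmetric] mult_2)
  ultimately show ?thesis
    unfolding root_poly_acc_def[of "insert m J"] sum.insert[OF assms] * by simp
qed

lemma poly_linear_mult:
  fixes q :: "complex poly"
  shows "poly (linear_poly c * q) y = (y - c) * poly q y"
    and "poly (pderiv (linear_poly c * q)) y = poly q y + (y - c) * poly (pderiv q) y"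
    and "poly (pderiv (pderiv (linear_poly c * q))) y =
           2 * poly (pderiv q) y + (y - c) * poly (pderiv (pderiv q)) y"
    and "poly (pderiv (pderiv (pderiv (linear_poly c * q)))) y =
           3 * poly (pderiv (pderiv q)) y + (y - c) * poly (pderiv (pderiv (pderiv q))) y"
  by (simp_all add: pderiv_mult pderiv_pCons pderiv_add algebra_simps)

text \<open>Logarithmic differentiation away from the nodes: with L = P'/P one has P''/P = L^2 + L',
  and L' is minus the pole sum of order 2. The mixed derivative is obtained in the same way.\<close>

lemma poly_derivs_root_poly:
  assumes "finite J" and "y \<notin> x ` J"
  shows "poly (pderiv (root_poly J x)) y =
           poly (root_poly J x) y * pole_sum J x (\<lambda>_. 1) 1 y" (is "?A J")
    and "poly (pderiv (pderiv (root_poly J x))) y =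
           poly (root_poly J x) y * ((pole_sum J x (\<lambda>_. 1) 1 y)^2 - pole_sum J x (\<lambda>_. 1) 2 y)" (is "?B J")
    and "poly (root_poly_vel J x u) y =
           - poly (root_poly J x) y * pole_sum J x u 1 y" (is "?C J")
    and "poly (pderiv (root_poly_vel J x u)) y =
           - poly (root_poly J x) y *
             (pole_sum J x u 1 y * pole_sum J x (\<lambda>_. 1) 1 y - pole_sum J x u 2 y)" (is "?D J")
proof -
  have "?A J \<and> ?B J \<and> ?C J \<and> ?D J"
    using assms
  proof (induction J rule: finite_induct)
    case (insert m J)
    \<comment> \<open>\<open>inverse (y - x m)\<close> acts as a further indeterminate subject to
      this single relation, which reduces all four claims to polynomial identities for
      \<open>algebra\<close>.\<close>
    then have d: "(y - x m) * inverse (y - x m) = 1"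
      by simp
    have IH: "?A J" "?B J" "?C J" "?D J"
      using insert.IH insert.prems by simp_all
    show ?case
      unfolding root_poly_insert[OF insert.hyps] root_poly_vel_insert[OF insert.hyps]
        pole_sum_insert[OF insert.hyps] poly_linear_mult IH pderiv_diff pderiv_smult poly_diff
        poly_smult power_one_right power2_eq_square mult_1_left
      using d by (intro conjI; algebra)
  qed (simp_all)
  then show "?A J" "?B J" "?C J" "?D J"
    by - (elim conjE, assumption)+
qed


text \<open>Split off the vanishing factor: P = (X - x n) R, so the k-th X-derivative of P at
  \<open>x n\<close> is k times the (k - 1)-st of R, and R has no root there. This is the dictionary
  between linear differential operators and many-body forces; the last line yields the goldfish
  interaction.\<close>

lemma node_values:
  fixes x u w :: "'i \<Rightarrow> complex"
  assumes "finite I" and "n \<in> I" and "inj_on x I"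
  defines "q \<equiv> poly (root_poly (I - {n}) x) (x n)"
    and "b \<equiv> \<lambda>f k. pole_sum (I - {n}) x f k (x n)"
  shows "poly (root_poly I x) (x n) = 0"
    and "poly (pderiv (root_poly I x)) (x n) = q"
    and "poly (pderiv (pderiv (root_poly I x))) (x n) = 2 * q * b (\<lambda>_. 1) 1"
    and "poly (pderiv (pderiv (pderiv (root_poly I x)))) (x n) =
           3 * q * ((b (\<lambda>_. 1) 1)^2 - b (\<lambda>_. 1) 2)"
    and "poly (root_poly_vel I x u) (x n) = - u n * q"
    and "poly (pderiv (root_poly_vel I x u)) (x n) = - q * (b u 1 + u n * b (\<lambda>_. 1) 1)"
    and "poly (pderiv (pderiv (root_poly_vel I x u))) (x n) =
           - q * (2 * (b u 1 * b (\<lambda>_. 1) 1 - b u 2) + u n * ((b (\<lambda>_. 1) 1)^2 - b (\<lambda>_. 1) 2))"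
    and "poly (root_poly_acc I x u w) (x n) = q * (2 * u n * b u 1 - w n)"
proof -
  define J where "J = I - {n}"
  have I: "I = insert n J" and J: "finite J" "n \<notin> J" "x n \<notin> x ` J"
    using assms(1-3) by (auto simp: J_def inj_on_def)
  have IJ: "insert n J - {n} = J"
    using J(2) by simp
  note P = root_poly_insert[OF J(1,2)] root_poly_vel_insert[OF J(1,2)] root_poly_acc_insert[OF J(1,2)]
    and v = poly_derivs_root_poly[OF J(1,3)]
  show "poly (root_poly I x) (x n) = 0"
    "poly (pderiv (root_poly I x)) (x n) = q"
    "poly (pderiv (pderiv (root_poly I x))) (x n) = 2 * q * b (\<lambda>_. 1) 1"
    "poly (pderiv (pderiv (pderiv (root_poly I x)))) (x n) =
           3 * q * ((b (\<lambda>_. 1) 1)^2 - b (\<lambda>_. 1) 2)"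
    "poly (root_poly_vel I x u) (x n) = - u n * q"
    "poly (pderiv (root_poly_vel I x u)) (x n) = - q * (b u 1 + u n * b (\<lambda>_. 1) 1)"
    "poly (pderiv (pderiv (root_poly_vel I x u))) (x n) =
           - q * (2 * (b u 1 * b (\<lambda>_. 1) 1 - b u 2) + u n * ((b (\<lambda>_. 1) 1)^2 - b (\<lambda>_. 1) 2))"
    "poly (root_poly_acc I x u w) (x n) = q * (2 * u n * b u 1 - w n)"
    unfolding q_def b_def I IJ P pderiv_diff pderiv_smult poly_diff poly_smult
      poly_linear_mult v
    by (simp_all add: algebra_simps)
qed

section \<open>Root counting and coefficients of X^j P^(j)\<close>

lemma poly_eq_0_if_many_roots:
  fixes p :: "complex poly"
  assumes "finite I" and "inj_on x I" and roots: "\<And>n. n \<in> I \<Longrightarrow> poly p (x n) = 0"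
    and deg: "\<And>k. k \<ge> card I \<Longrightarrow> coeff p k = 0"
  shows "p = 0"
proof (rule ccontr)
  assume p: "p \<noteq> 0"
  have "degree p < card I"
    by (rule ccontr) (use deg[of "degree p"] p in auto)
  also have "card I = card (x ` I)"
    using assms(2) by (simp add: card_image)
  also have "\<dots> \<le> card {y. poly p y = 0}"
    using roots p by (intro card_mono poly_roots_finite) auto
  also have "\<dots> \<le> degree p"
    by (rule card_poly_roots_bound[OF p])
  finally show False by simp
qed

text \<open>The Euler operators X^j (d/dX)^j act diagonally on monomials, with falling factorials as
  eigenvalues; here j = 1, and j = 2, 3 follow.\<close>

lemma coeff_pCons_pderiv:
  "coeff (pCons 0 (pderiv p)) k = of_nat k * coeff (p :: complex poly) k"
  by (cases k) (simp_all add: coeff_pderiv)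

lemma coeff_pCons2_pderiv2:
  "coeff (pCons 0 (pCons 0 (pderiv (pderiv p)))) k =
     of_nat k * (of_nat k - 1) * coeff (p :: complex poly) k"
  by (cases k) (simp_all add: coeff_pCons_pderiv coeff_pderiv)

lemma coeff_pCons3_pderiv3:
  "coeff (pCons 0 (pCons 0 (pCons 0 (pderiv (pderiv (pderiv p)))))) k =
     of_nat k * (of_nat k - 1) * (of_nat k - 2) * coeff (p :: complex poly) k"
  by (cases k) (simp_all add: coeff_pCons2_pderiv2 coeff_pderiv)

lemma coeff_root_poly_top:
  assumes "finite J"
  shows "coeff (root_poly J x) (card J) = 1"
    and "k > card J \<Longrightarrow> coeff (root_poly J x) k = 0"
proof -
  have "degree (root_poly J x) = card J \<and> lead_coeff (root_poly J x) = 1"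
    using assms
  proof (induction J rule: finite_induct)
    case (insert m J)
    then have "root_poly J x \<noteq> 0"
      by auto
    moreover have "degree (linear_poly (x m)) = 1" "lead_coeff (linear_poly (x m)) = 1"
      "linear_poly (x m) \<noteq> 0"
      by (auto simp: linear_poly_def)
    moreover have "degree (root_poly J x) = card J" "coeff (root_poly J x) (card J) = 1"
      using insert.IH by (auto dest: sym)
    ultimately show ?case
      using insert.hyps unfolding root_poly_insert[OF insert.hyps] lead_coeff_mult
      by (simp add: degree_mult_eq)
  qed simp
  then have d: "degree (root_poly J x) = card J" and l: "lead_coeff (root_poly J x) = 1"
    by blast+
  show "coeff (root_poly J x) (card J) = 1"
    using l by (simp only: d)
  show "k > card J \<Longrightarrow> coeff (root_poly J x) k = 0"
    by (simp add: coeff_eq_0 d)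
qed

section \<open>Double sums over the other particles, reduced to pole sums\<close>

lemma sum_pairs_add:
  "(\<Sum>(k, l)\<in>A. f k l + g k l) = (\<Sum>(k, l)\<in>A. f k l) + (\<Sum>(k, l)\<in>A. g k l)"
  by (simp add: case_prod_unfold sum.distrib)

lemma sum_pairs_diff:
  fixes f :: "nat \<Rightarrow> nat \<Rightarrow> complex"
  shows "(\<Sum>(k, l)\<in>A. f k l - g k l) = (\<Sum>(k, l)\<in>A. f k l) - (\<Sum>(k, l)\<in>A. g k l)"
  by (simp add: case_prod_unfold sum_subtractf)

lemma sum_pairs_cmult:
  fixes c :: complex
  shows "(\<Sum>(k, l)\<in>A. c * f k l) = c * (\<Sum>(k, l)\<in>A. f k l)"
  by (simp add: case_prod_unfold sum_distrib_left)

lemma sum_pairs_cong: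
  assumes "\<And>k l. (k, l) \<in> A \<Longrightarrow> f k l = g k l"
  shows "(\<Sum>(k, l)\<in>A. f k l) = (\<Sum>(k, l)\<in>A. g k l)"
  using assms by (intro sum.cong) auto

text \<open>The pairs are the square of \<open>others N n\<close> without its diagonal.\<close>

lemma sum_other_pairs:
  fixes f g :: "nat \<Rightarrow> complex"
  shows "(\<Sum>(k, l)\<in>other_pairs N n. f k * g l) =
    sum f (others N n) * sum g (others N n) - (\<Sum>l\<in>others N n. f l * g l)"
proof -
  have fin: "finite (others N n)"
    by (simp add: others_def)
  have "other_pairs N n = others N n \<times> others N n - (\<lambda>l. (l, l)) ` others N n"
    by (auto simp: other_pairs_def others_def)
  moreover have "(\<Sum>(k, l)\<in>others N n \<times> others N n. f k * g l) =
      sum f (others N n) * sum g (others N n)"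
    by (simp add: sum_product sum.cartesian_product)
  moreover have "(\<Sum>(k, l)\<in>(\<lambda>l. (l, l)) ` others N n. f k * g l) = (\<Sum>l\<in>others N n. f l * g l)"
    by (subst sum.reindex) (auto simp: inj_on_def)
  ultimately show ?thesis
    using fin by (simp add: sum_diff image_subset_iff)
qed

lemma sum_other_pairs_swap:
  "(\<Sum>(k, l)\<in>other_pairs N n. f k l) = (\<Sum>(k, l)\<in>other_pairs N n. f l k)"
  by (rule sum.reindex_bij_witness[of _ prod.swap prod.swap]) (auto simp: other_pairs_def)

lemma sum_pole_pair:
  fixes z :: "nat \<Rightarrow> complex"
  shows "(\<Sum>(k, l)\<in>other_pairs N n. c / ((z n - z l) * (z n - z k))) =
    c * ((pole_sum (others N n) z (\<lambda>_. 1) 1 (z n))^2 - pole_sum (others N n) z (\<lambda>_. 1) 2 (z n))"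
proof -
  have "(\<Sum>(k, l)\<in>other_pairs N n. c / ((z n - z l) * (z n - z k))) =
      (\<Sum>(k, l)\<in>other_pairs N n. (c / (z n - z k)) * (1 / (z n - z l)))"
    by (intro sum.cong) (auto simp: mult.commute)
  then show ?thesis
    unfolding sum_other_pairs
    by (simp add: pole_sum_def power2_eq_square algebra_simps sum_distrib_left)
qed

text \<open>The task is to remove the denominators \<open>z l - z k\<close>, which do not involve
  particle n. With r l = 1 / (z n - z l) one has r l - r k = (z l - z k) r l r k, so adding the term
  with k and l exchanged leaves (V l + V k) r l r k. The result is the bracket that
  \<open>node_values\<close> gives for the mixed third derivative.\<close>

lemma sum_pole_pair_vel:
  fixes z V :: "nat \<Rightarrow> complex"
  assumes inj: "inj_on z {1..N}" and n: "n \<in> {1..N}"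
  defines "b \<equiv> \<lambda>f k. pole_sum (others N n) z f k (z n)"
  shows "(\<Sum>(k, l)\<in>other_pairs N n.
      c / (z n - z l) * ((V n + V k) / (z n - z k) + (V l + V k) / (z l - z k))) =
    c * (V n * ((b (\<lambda>_. 1) 1)^2 - b (\<lambda>_. 1) 2) + 2 * (b V 1 * b (\<lambda>_. 1) 1 - b V 2))"
proof -
  define r where "r l = 1 / (z n - z l)" for l
  have b1: "b f 1 = (\<Sum>l\<in>others N n. f l * r l)" for f
    by (simp add: b_def pole_sum_def r_def)
  have b2: "b f 2 = (\<Sum>l\<in>others N n. f l * r l * r l)" for f
    by (simp add: b_def pole_sum_def r_def power2_eq_square)
  define X where "X = (\<Sum>(k, l)\<in>other_pairs N n. r l * ((V l + V k) / (z l - z k)))"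
  \<comment> \<open>Symmetrizing in \<open>k\<close> and \<open>l\<close> cancels the denominator \<open>z l - z k\<close>.\<close>
  have "2 * X = X + (\<Sum>(k, l)\<in>other_pairs N n. r k * ((V k + V l) / (z k - z l)))"
    unfolding X_def sum_other_pairs_swap[of "\<lambda>k l. r k * ((V k + V l) / (z k - z l))"] by simp
  also have "\<dots> = (\<Sum>(k, l)\<in>other_pairs N n. (V k * r k) * r l + r k * (V l * r l))"
    unfolding X_def sum_pairs_add[symmetric]
  proof (rule sum_pairs_cong)
    fix k l assume "(k, l) \<in> other_pairs N n"
    then have "k \<in> {1..N}" "l \<in> {1..N}" "k \<noteq> n" "l \<noteq> n" "k \<noteq> l"
      unfolding other_pairs_def by blast+
    with inj_onD[OF inj, of n l] inj_onD[OF inj, of n k] inj_onD[OF inj, of l k] n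
    have "z n \<noteq> z l" "z n \<noteq> z k" "z l \<noteq> z k"
      by blast+
    then show "r l * ((V l + V k) / (z l - z k)) + r k * ((V k + V l) / (z k - z l)) =
        (V k * r k) * r l + r k * (V l * r l)"
      unfolding r_def by (simp add: divide_simps) (simp add: algebra_simps)
  qed
  also have "\<dots> = 2 * (b V 1 * b (\<lambda>_. 1) 1 - b V 2)"
    unfolding sum_pairs_add sum_other_pairs b1 b2 by (simp add: mult_ac)
  finally have X: "X = b V 1 * b (\<lambda>_. 1) 1 - b V 2"
    by (simp only: mult_cancel_left) simp
  have "(\<Sum>(k, l)\<in>other_pairs N n.
      c / (z n - z l) * ((V n + V k) / (z n - z k) + (V l + V k) / (z l - z k))) =
    (\<Sum>(k, l)\<in>other_pairs N n. c * (V n * (r k * r l) + (V k * r k) * r l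
       + r l * ((V l + V k) / (z l - z k))))"
  proof (rule sum_pairs_cong)
    fix k l
    have "c / (z n - z l) * ((V n + V k) / (z n - z k) + D) =
        c * (V n * (r k * r l) + (V k * r k) * r l + r l * D)" for D
    proof -
      have "c / (z n - z l) = c * r l" "(V n + V k) / (z n - z k) = (V n + V k) * r k"
        by (simp_all add: r_def)
      then show ?thesis
        by (simp only:) (simp add: algebra_simps)
    qed
    then show "c / (z n - z l) * ((V n + V k) / (z n - z k) + (V l + V k) / (z l - z k)) =
        c * (V n * (r k * r l) + (V k * r k) * r l + r l * ((V l + V k) / (z l - z k)))" .
  qed
  also have "\<dots> = c * (V n * ((b (\<lambda>_. 1) 1)^2 - b (\<lambda>_. 1) 2) + (b V 1 * b (\<lambda>_. 1) 1 - b V 2) + X)"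
    unfolding sum_pairs_cmult sum_pairs_add X_def[symmetric] sum_other_pairs b1 b2
    by (simp add: power2_eq_square)
  finally show ?thesis
    unfolding X by simp
qed


section \<open>Trajectories in rescaled variables\<close>

lemma eq_mult_mult_inverse: "p * k = 1 \<Longrightarrow> b = p * (b * k)" for p k b :: complex
  by (simp add: mult.left_commute)

lemma mult_mult_eq: "p * k = k' \<Longrightarrow> p * (b * k) = b * k'" for p k k' b :: complex
  by (simp add: mult.left_commute)

text \<open>Pure kinematics, with \<open>lam\<close> left free: each system later supplies its
  equation of motion together with its own value of \<open>lam\<close>.\<close>

locale goldfish_trajectory =
  fixes N :: nat and \<omega> lam :: real and z v a :: "nat \<Rightarrow> real \<Rightarrow> complex"
  assumes N_pos: "N > 0" and omega_pos: "\<omega> > 0"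
    and inj_z: "\<And>t. inj_on (\<lambda>n. z n t) {1..N}"
    and deriv_z: "\<And>n t. n \<in> {1..N} \<Longrightarrow> (z n has_vector_derivative v n t) (at t)"
    and deriv_v: "\<And>n t. n \<in> {1..N} \<Longrightarrow> (v n has_vector_derivative a n t) (at t)"
begin

text \<open>In terms of the complex time \<open>\<tau>\<close> with \<open>d\<tau>/dt = E t\<close>, the functions \<open>u n\<close> and \<open>w n\<close> are the first
  and second derivatives of \<open>x n\<close>; likewise \<open>\<psi>'\<close> and \<open>\<psi>''\<close> below are \<open>\<tau>\<close>-derivatives.\<close>

definition c :: complex where "c = \<i> * of_real (lam * \<omega>)"

definition E :: "real \<Rightarrow> complex" where "E t = cis (\<omega> * t)"
definition s :: "real \<Rightarrow> complex" where "s t = cis (lam * \<omega> * t)"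

definition x :: "nat \<Rightarrow> real \<Rightarrow> complex" where
  "x n t = z n t * cis (- (lam * \<omega>) * t)"
definition u :: "nat \<Rightarrow> real \<Rightarrow> complex" where
  "u n t = (v n t - c * z n t) * cis (- ((lam + 1) * \<omega>) * t)"
definition w :: "nat \<Rightarrow> real \<Rightarrow> complex" where
  "w n t = (a n t - (2 * c + \<i> * of_real \<omega>) * v n t + c * (c + \<i> * of_real \<omega>) * z n t)
             * cis (- ((lam + 2) * \<omega>) * t)"

lemma E_nonzero [simp]: "E t \<noteq> 0" and s_nonzero [simp]: "s t \<noteq> 0"
  by (simp_all add: E_def s_def)

lemma z_eq: "z n t = s t * x n t"
proof -
  have "s t * cis (- (lam * \<omega>) * t) = 1"
    by (simp add: s_def cis_mult)
  then show ?thesis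
    unfolding x_def by (rule eq_mult_mult_inverse)
qed

lemma v_eq: "v n t - c * z n t = s t * E t * u n t"
proof -
  have "s t * E t * cis (- ((lam + 1) * \<omega>) * t) = 1"
    by (simp add: s_def E_def cis_mult algebra_simps)
  then show ?thesis
    unfolding u_def by (rule eq_mult_mult_inverse)
qed

text \<open>The left side is (d/dt - c - \<i> \<omega>)(d/dt - c) applied to z: each complex-time
  derivative strips one more power of \<open>E\<close>.\<close>

lemma a_eq: "a n t - (2 * c + \<i> * of_real \<omega>) * v n t + c * (c + \<i> * of_real \<omega>) * z n t =
    s t * (E t)^2 * w n t"
proof -
  have "s t * (E t)^2 * cis (- ((lam + 2) * \<omega>) * t) = 1"
    by (simp add: s_def E_def power2_eq_square cis_mult algebra_simps)
  then show ?thesis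
    unfolding w_def by (rule eq_mult_mult_inverse)
qed

lemma deriv_x:
  assumes n: "n \<in> {1..N}"
  shows "(x n has_vector_derivative E t * u n t) (at t)"
proof -
  let ?e = "\<lambda>t. cis (- (lam * \<omega>) * t)"
  have "((\<lambda>t. z n t * ?e t) has_vector_derivative
      z n t * (\<i> * of_real (- (lam * \<omega>)) * ?e t) + v n t * ?e t) (at t)"
    by (intro has_vector_derivative_mult has_vector_derivative_cis_linear deriv_z n)
  moreover have "E t * cis (- ((lam + 1) * \<omega>) * t) = ?e t"
    by (simp add: E_def cis_mult algebra_simps)
  then have "E t * u n t = (v n t - c * z n t) * ?e t"
    unfolding u_def by (rule mult_mult_eq)
  then have "E t * u n t = z n t * (\<i> * of_real (- (lam * \<omega>)) * ?e t) + v n t * ?e t"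
    by (simp add: c_def ring_distribs mult_ac)
  ultimately show ?thesis
    unfolding x_def[abs_def] by (simp only:)
qed

lemma deriv_u:
  assumes n: "n \<in> {1..N}"
  shows "(u n has_vector_derivative E t * w n t) (at t)"
proof -
  let ?e = "\<lambda>t. cis (- ((lam + 1) * \<omega>) * t)"
  have "((\<lambda>t. (v n t - c * z n t) * ?e t) has_vector_derivative
      (v n t - c * z n t) * (\<i> * of_real (- ((lam + 1) * \<omega>)) * ?e t) + (a n t - c * v n t) * ?e t) (at t)"
    by (intro has_vector_derivative_mult has_vector_derivative_diff has_vector_derivative_mult_right
         has_vector_derivative_cis_linear deriv_z deriv_v n)
  note * = this
  have "E t * cis (- ((lam + 2) * \<omega>) * t) = ?e t"
    by (simp add: E_def cis_mult algebra_simps)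
  then have "E t * w n t =
      (a n t - (2 * c + \<i> * of_real \<omega>) * v n t + c * (c + \<i> * of_real \<omega>) * z n t) * ?e t"
    unfolding w_def by (rule mult_mult_eq)
  moreover have "\<i> * of_real (- ((lam + 1) * \<omega>)) = - (c + \<i> * of_real \<omega>)"
    by (simp add: c_def algebra_simps)
  ultimately have "E t * w n t = (v n t - c * z n t) * (\<i> * of_real (- ((lam + 1) * \<omega>)) * ?e t)
      + (a n t - c * v n t) * ?e t"
    by (simp only:) (simp only: ring_distribs mult_ac mult_2 minus_add_distrib
        mult_minus_left mult_minus_right diff_conv_add_uminus minus_minus add_ac)
  with * show ?thesis
    unfolding u_def[abs_def] by (simp only:)
qed

definition \<psi> :: "real \<Rightarrow> complex poly" where
  "\<psi> t = root_poly {1..N} (\<lambda>n. x n t)"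
definition \<psi>' :: "real \<Rightarrow> complex poly" where
  "\<psi>' t = root_poly_vel {1..N} (\<lambda>n. x n t) (\<lambda>n. u n t)"
definition \<psi>'' :: "real \<Rightarrow> complex poly" where
  "\<psi>'' t = root_poly_acc {1..N} (\<lambda>n. x n t) (\<lambda>n. u n t) (\<lambda>n. w n t)"

lemma has_poly_derivative_root_poly:
  assumes "J \<subseteq> {1..N}"
  shows "has_poly_derivative E (\<lambda>t. root_poly J (\<lambda>n. x n t))
           (\<lambda>t. root_poly_vel J (\<lambda>n. x n t) (\<lambda>n. u n t))"
proof -
  have "finite J"
    using assms finite_subset by blast
  then show ?thesis
    using assms
  proof (induction J rule: finite_induct)
    case (insert m J)
    have "has_poly_derivative E (\<lambda>t. linear_poly (x m t)) (\<lambda>t. [:- u m t:])"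
      using deriv_x[of m] insert.prems
      by (auto simp: has_poly_derivative_def linear_poly_def coeff_pCons split: nat.split
          intro!: has_vector_derivative_minus)
    from has_poly_derivative_mult[OF this] insert show ?case
      by (simp add: root_poly_insert root_poly_vel_insert)
  qed (simp add: has_poly_derivative_0)
qed

lemma has_poly_derivative_smult:
  assumes "\<And>t. (f has_vector_derivative E t * f' t) (at t)" and "has_poly_derivative E p p'"
  shows "has_poly_derivative E (\<lambda>t. smult (f t) (p t)) (\<lambda>t. smult (f' t) (p t) + smult (f t) (p' t))"
  unfolding has_poly_derivative_def
proof (intro allI)
  fix k t
  have "((\<lambda>t. f t * coeff (p t) k) has_vector_derivative
      f t * (E t * coeff (p' t) k) + E t * f' t * coeff (p t) k) (at t)"
    using assms unfolding has_poly_derivative_def by (intro has_vector_derivative_mult) auto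
  then show "((\<lambda>t. coeff (smult (f t) (p t)) k) has_vector_derivative
      E t * coeff (smult (f' t) (p t) + smult (f t) (p' t)) k) (at t)"
    by (simp add: algebra_simps)
qed

lemma deriv_psi: "has_poly_derivative E \<psi> \<psi>'"
  unfolding \<psi>_def[abs_def] \<psi>'_def[abs_def] by (rule has_poly_derivative_root_poly) simp

lemma deriv_psi': "has_poly_derivative E \<psi>' \<psi>''"
  unfolding \<psi>'_def[abs_def] \<psi>''_def[abs_def] root_poly_vel_def[of "{1..N}"] root_poly_acc_def
proof (intro has_poly_derivative_minus has_poly_derivative_sum)
  fix l assume l: "l \<in> {1..N}"
  then have "{1..N} - {l} \<subseteq> {1..N}"
    by blast
  from has_poly_derivative_smult[OF deriv_u[OF l] has_poly_derivative_root_poly[OF this]]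
  show "has_poly_derivative E (\<lambda>t. smult (u l t) (root_poly ({1..N} - {l}) (\<lambda>n. x n t)))
     (\<lambda>t. smult (w l t) (root_poly ({1..N} - {l}) (\<lambda>n. x n t)) +
       smult (u l t) (root_poly_vel ({1..N} - {l}) (\<lambda>n. x n t) (\<lambda>n. u n t)))" .
qed

lemma coeff_psi_N: "coeff (\<psi> t) N = 1"
  using coeff_root_poly_top(1)[of "{1..N}" "\<lambda>n. x n t"] by (simp add: \<psi>_def)

lemma coeff_psi_high: "k > N \<Longrightarrow> coeff (\<psi> t) k = 0"
  using coeff_root_poly_top(2)[of "{1..N}" k "\<lambda>n. x n t"] by (simp add: \<psi>_def)

lemma coeff_psi'_high:
  assumes "k \<ge> N" shows "coeff (\<psi>' t) k = 0"
proof -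
  have "coeff (\<psi> t) k = (if k = N then 1 else 0)" for t
    using assms coeff_psi_N coeff_psi_high by simp
  then show ?thesis
    by (rule has_poly_derivative_coeff_const[OF E_nonzero deriv_psi])
qed

lemma coeff_psi''_high: "k \<ge> N \<Longrightarrow> coeff (\<psi>'' t) k = 0"
  by (rule has_poly_derivative_coeff_const[OF E_nonzero deriv_psi' coeff_psi'_high])

lemma inj_x: "inj_on (\<lambda>n. x n t) {1..N}"
proof (rule inj_onI)
  fix n m assume "n \<in> {1..N}" "m \<in> {1..N}" "x n t = x m t"
  then show "n = m"
    using inj_onD[OF inj_z[of t], of n m] by (simp add: x_def)
qed

lemma others_eq: "others N n = {1..N} - {n}"
  by (auto simp: others_def)

definition q :: "nat \<Rightarrow> real \<Rightarrow> complex" where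
  "q n t = poly (root_poly (others N n) (\<lambda>l. x l t)) (x n t)"
definition pole :: "(nat \<Rightarrow> real \<Rightarrow> complex) \<Rightarrow> nat \<Rightarrow> nat \<Rightarrow> real \<Rightarrow> complex" where
  "pole f k n t = pole_sum (others N n) (\<lambda>l. x l t) (\<lambda>l. f l t) k (x n t)"

abbreviation "pole1 \<equiv> pole (\<lambda>_ _. 1)"

text \<open>The nonzero values all share the factor \<open>q n t\<close>, so a suitable linear
  combination at node n is \<open>q n t\<close> times the equation of motion and vanishes.\<close>

lemma psi_values:
  assumes "n \<in> {1..N}"
  shows "poly (\<psi> t) (x n t) = 0"
    and "poly (pderiv (\<psi> t)) (x n t) = q n t"
    and "poly (pderiv (pderiv (\<psi> t))) (x n t) = 2 * q n t * pole1 1 n t"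
    and "poly (pderiv (pderiv (pderiv (\<psi> t)))) (x n t) =
           3 * q n t * ((pole1 1 n t)^2 - pole1 2 n t)"
    and "poly (\<psi>' t) (x n t) = - u n t * q n t"
    and "poly (pderiv (\<psi>' t)) (x n t) = - q n t * (pole u 1 n t + u n t * pole1 1 n t)"
    and "poly (pderiv (pderiv (\<psi>' t))) (x n t) =
           - q n t * (2 * (pole u 1 n t * pole1 1 n t - pole u 2 n t)
              + u n t * ((pole1 1 n t)^2 - pole1 2 n t))"
    and "poly (\<psi>'' t) (x n t) = q n t * (2 * u n t * pole u 1 n t - w n t)"
  unfolding q_def pole_def \<psi>_def \<psi>'_def \<psi>''_def others_eq
  by (fact node_values[OF finite_atLeastAtMost assms inj_x])+

lemma poly_eq_0_if_vanishes_on_x: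
  assumes "\<And>n. n \<in> {1..N} \<Longrightarrow> poly p (x n t) = 0" and "\<And>k. k \<ge> N \<Longrightarrow> coeff p k = 0"
  shows "p = 0"
  by (rule poly_eq_0_if_many_roots[OF _ inj_x]) (use assms in auto)

lemma pole_sum_z:
  "pole_sum (others N n) (\<lambda>l. z l t) (\<lambda>l. f l t) k (z n t) = inverse (s t) ^ k * pole f k n t"
proof -
  have "f l t / (z n t - z l t) ^ k = inverse (s t) ^ k * (f l t / (x n t - x l t) ^ k)" for l
  proof -
    have "z n t - z l t = s t * (x n t - x l t)"
      by (simp only: z_eq right_diff_distrib)
    then show ?thesis
      by (simp only: power_mult_distrib divide_inverse inverse_mult_distrib power_inverse
          mult.left_commute)
  qed
  then show ?thesis
    by (simp add: pole_sum_def pole_def sum_distrib_left)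
qed

lemma pole_v: "pole (\<lambda>l t. v l t - c * z l t) k n t = s t * E t * pole u k n t"
  unfolding pole_def pole_sum_def v_eq sum_distrib_left by (simp add: mult.assoc)

lemma pole_sums:
  "pole_sum (others N n) (\<lambda>l. z l t) (\<lambda>_. 1) 1 (z n t) = inverse (s t) * pole1 1 n t"
  "pole_sum (others N n) (\<lambda>l. z l t) (\<lambda>_. 1) 2 (z n t) = (inverse (s t))^2 * pole1 2 n t"
  "pole_sum (others N n) (\<lambda>l. z l t) (\<lambda>l. v l t - c * z l t) 1 (z n t) = E t * pole u 1 n t"
  "pole_sum (others N n) (\<lambda>l. z l t) (\<lambda>l. v l t - c * z l t) 2 (z n t) =
     inverse (s t) * E t * pole u 2 n t"
  using pole_sum_z[of n t "\<lambda>_ _. 1" 1] pole_sum_z[of n t "\<lambda>_ _. 1" 2]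
  by (simp_all add: pole_sum_z[where f = "\<lambda>l t. v l t - c * z l t"] pole_v power2_eq_square)

end


section \<open>The six systems\<close>

text \<open>Brings the system to the normal form used for all six: the left side is that of
  \<open>a_eq\<close>, with c equal to \<i> lam \<omega>, and the interactions are pole sums at
  particle n, whose scaling is known.\<close>

lemma system1_iff:
  fixes N n :: nat and \<omega> :: real and z v a :: "nat \<Rightarrow> complex"
  defines "c \<equiv> - 2 * (\<i> * of_real \<omega>)"
  defines "V \<equiv> \<lambda>l. v l - c * z l"
    and "b \<equiv> \<lambda>f k. pole_sum (others N n) z f k (z n)"
  shows "system1 N \<omega> B0 F2 z v a n \<longleftrightarrow>
    a n - (2 * c + \<i> * of_real \<omega>) * v n + c * (c + \<i> * of_real \<omega>) * z n =
      B0 + 2 * (V n * b V 1) + 3 * F2 * (z n)^2 * ((b (\<lambda>_. 1) 1)^2 - b (\<lambda>_. 1) 2)"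
proof -
  have V: "v l + 2 * \<i> * of_real \<omega> * z l = V l" for l
    by (simp add: V_def c_def)
  have lhs: "a n + 3 * \<i> * of_real \<omega> * v n - 2 * (of_real \<omega>)^2 * z n =
      a n - (2 * c + \<i> * of_real \<omega>) * v n + c * (c + \<i> * of_real \<omega>) * z n"
    by (simp add: c_def algebra_simps power2_eq_square)
  have sums: "(\<Sum>l\<in>others N n. V n * V l / (z n - z l)) = V n * b V 1"
    by (simp add: b_def pole_sum_def sum_distrib_left)
  show ?thesis
    unfolding system1_def V lhs sums sum_pole_pair b_def ..
qed

lemma system2_iff:
  fixes N n :: nat and \<omega> :: real and z v a :: "nat \<Rightarrow> complex"
  assumes "inj_on z {1..N}" and "n \<in> {1..N}"
  defines "c \<equiv> - (\<i> * of_real \<omega>)"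
  defines "V \<equiv> \<lambda>l. v l - c * z l"
    and "b \<equiv> \<lambda>f k. pole_sum (others N n) z f k (z n)"
  shows "system2 N \<omega> A0 D0 F1 G1 z v a n \<longleftrightarrow>
    a n - (2 * c + \<i> * of_real \<omega>) * v n + c * (c + \<i> * of_real \<omega>) * z n =
      (2 * V n * b V 1 + 2 * A0 * b (\<lambda>_. 1) 1 - D0 * (V n * b (\<lambda>_. 1) 1 + b V 1))
      + (3 * F1 * z n * ((b (\<lambda>_. 1) 1)^2 - b (\<lambda>_. 1) 2)
        - G1 * z n *
          (V n * ((b (\<lambda>_. 1) 1)^2 - b (\<lambda>_. 1) 2) + 2 * (b V 1 * b (\<lambda>_. 1) 1 - b V 2)))"
proof -
  have V: "v l + \<i> * of_real \<omega> * z l = V l"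
    "v l + v k + \<i> * of_real \<omega> * (z l + z k) = V l + V k" for l k
    by (simp_all add: V_def c_def algebra_simps)
  have lhs: "a n + \<i> * of_real \<omega> * v n =
      a n - (2 * c + \<i> * of_real \<omega>) * v n + c * (c + \<i> * of_real \<omega>) * z n"
    by (simp add: c_def)
  have sums: "(\<Sum>l\<in>others N n. (2 * V n * V l + 2 * A0 - D0 * (V n + V l)) / (z n - z l)) =
      2 * V n * b V 1 + 2 * A0 * b (\<lambda>_. 1) 1 - D0 * (V n * b (\<lambda>_. 1) 1 + b V 1)"
    by (simp add: b_def pole_sum_def sum_distrib_left add_divide_distrib diff_divide_distrib
        sum.distrib sum_subtractf ring_distribs mult.assoc)
  show ?thesis
    unfolding system2_def V lhs sums sum_pairs_diff sum_pole_pair sum_pole_pair_vel[OF assms(1,2)]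
      b_def ..
qed

lemma system3_iff:
  fixes N n :: nat and \<omega> :: real and z v a :: "nat \<Rightarrow> complex"
  defines "c \<equiv> - (2 / 3) * (\<i> * of_real \<omega>)"
  defines "V \<equiv> \<lambda>l. v l - c * z l"
    and "b \<equiv> \<lambda>f k. pole_sum (others N n) z f k (z n)"
  shows "system3 N \<omega> F0 z v a n \<longleftrightarrow>
    a n - (2 * c + \<i> * of_real \<omega>) * v n + c * (c + \<i> * of_real \<omega>) * z n =
      2 * (V n * b V 1) + 3 * F0 * ((b (\<lambda>_. 1) 1)^2 - b (\<lambda>_. 1) 2)"
proof -
  have V: "v l + 2 * \<i> * of_real \<omega> * z l / 3 = V l" for l
    by (simp add: V_def c_def)
  have lhs: "a n + \<i> * of_real \<omega> / 3 * v n + 2 / 9 * (of_real \<omega>)^2 * z n =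
      a n - (2 * c + \<i> * of_real \<omega>) * v n + c * (c + \<i> * of_real \<omega>) * z n"
    by (simp add: c_def field_simps power2_eq_square)
  have sums: "(\<Sum>l\<in>others N n. V n * V l / (z n - z l)) = V n * b V 1"
    by (simp add: b_def pole_sum_def sum_distrib_left)
  show ?thesis
    unfolding system3_def V lhs sums sum_pole_pair b_def ..
qed

lemma system4_iff:
  fixes N n :: nat and \<omega> :: real and z v a :: "nat \<Rightarrow> complex"
  assumes "inj_on z {1..N}" and "n \<in> {1..N}"
  defines "c \<equiv> - (1 / 2) * (\<i> * of_real \<omega>)"
  defines "V \<equiv> \<lambda>l. v l - c * z l"
    and "b \<equiv> \<lambda>f k. pole_sum (others N n) z f k (z n)"
  shows "system4 N \<omega> G0 z v a n \<longleftrightarrow>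
    a n - (2 * c + \<i> * of_real \<omega>) * v n + c * (c + \<i> * of_real \<omega>) * z n =
      2 * (V n * b V 1)
      - G0 * (V n * ((b (\<lambda>_. 1) 1)^2 - b (\<lambda>_. 1) 2) + 2 * (b V 1 * b (\<lambda>_. 1) 1 - b V 2))"
proof -
  have V: "v l + \<i> * of_real \<omega> * z l / 2 = V l"
    "v l + v k + \<i> * of_real \<omega> * (z l + z k) / 2 = V l + V k" for l k
    by (simp_all add: V_def c_def field_simps)
  have lhs: "a n + (of_real \<omega>)^2 / 4 * z n =
      a n - (2 * c + \<i> * of_real \<omega>) * v n + c * (c + \<i> * of_real \<omega>) * z n"
    by (simp add: c_def field_simps power2_eq_square)
  have sums: "(\<Sum>l\<in>others N n. V n * V l / (z n - z l)) = V n * b V 1"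
    by (simp add: b_def pole_sum_def sum_distrib_left)
  show ?thesis
    unfolding system4_def V lhs sums sum_pole_pair_vel[OF assms(1,2)] b_def ..
qed

lemma card_others: "n \<in> {1..N} \<Longrightarrow> of_nat (card (others N n)) = (of_nat N - 1 :: complex)"
proof -
  assume n: "n \<in> {1..N}"
  then have "others N n = {1..N} - {n}"
    by (auto simp: others_def)
  with n show ?thesis
    by (auto simp: of_nat_diff)
qed

lemma system5_iff:
  fixes N n :: nat and \<omega> :: real and z v a :: "nat \<Rightarrow> complex"
  assumes "inj_on z {1..N}" and "n \<in> {1..N}"
  defines "c \<equiv> \<i> * of_real \<omega>"
  defines "V \<equiv> \<lambda>l. v l - c * z l"
    and "b \<equiv> \<lambda>f k. pole_sum (others N n) z f k (z n)"
  shows "system5 N \<omega> D2 G3 z v a n \<longleftrightarrow>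
    a n - (2 * c + \<i> * of_real \<omega>) * v n + c * (c + \<i> * of_real \<omega>) * z n =
      (of_nat N - 1) * (of_nat N - 2) * G3 * V n * z n
      + (2 * V n * b V 1
         - D2 * z n * (V n * (z n * b (\<lambda>_. 1) 1 - (of_nat N - 1)) + z n * b V 1))
      - G3 * (z n)^3 *
        (V n * ((b (\<lambda>_. 1) 1)^2 - b (\<lambda>_. 1) 2) + 2 * (b V 1 * b (\<lambda>_. 1) 1 - b V 2))"
proof -
  have V: "v l - \<i> * of_real \<omega> * z l = V l"
    "v l + v k - \<i> * of_real \<omega> * (z l + z k) = V l + V k" for l k
    by (simp_all add: V_def c_def algebra_simps)
  have lhs: "a n - 3 * \<i> * of_real \<omega> * v n - 2 * (of_real \<omega>)^2 * z n =
      a n - (2 * c + \<i> * of_real \<omega>) * v n + c * (c + \<i> * of_real \<omega>) * z n"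
    by (simp add: c_def algebra_simps power2_eq_square)
  have "(\<Sum>l\<in>others N n. (2 * V n * V l - D2 * z n * (V n * z l + V l * z n)) / (z n - z l)) =
      (\<Sum>l\<in>others N n. 2 * V n * (V l / (z n - z l)) - D2 * z n * (V n * (z n * (1 / (z n - z l)) - 1)
         + z n * (V l / (z n - z l))))"
  proof (rule sum.cong[OF refl])
    fix l assume "l \<in> others N n"
    then have "l \<in> {1..N}" "l \<noteq> n"
      by (simp_all add: others_def)
    with assms(1,2) have "z n - z l \<noteq> 0"
      by (simp add: inj_on_eq_iff)
    \<comment> \<open>Removes \<open>z l\<close> from the numerator; summed over the N - 1 other
      particles, the term -1 produces \<open>of_nat N - 1\<close>.\<close>
    then have z: "z l / (z n - z l) = z n * (1 / (z n - z l)) - 1"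
      by (simp add: field_simps)
    have "V n * z l / (z n - z l) = V n * (z n * (1 / (z n - z l)) - 1)"
      using arg_cong[OF z, of "\<lambda>y. V n * y"] by (simp only: times_divide_eq_right)
    then have "(V n * z l + V l * z n) / (z n - z l) =
        V n * (z n * (1 / (z n - z l)) - 1) + z n * (V l / (z n - z l))"
      by (simp add: add_divide_distrib mult.commute)
    from arg_cong[OF this, of "\<lambda>y. D2 * z n * y"]
    have "D2 * z n * (V n * z l + V l * z n) / (z n - z l) =
        D2 * z n * (V n * (z n * (1 / (z n - z l)) - 1) + z n * (V l / (z n - z l)))"
      by (simp only: times_divide_eq_right)
    then show "(2 * V n * V l - D2 * z n * (V n * z l + V l * z n)) / (z n - z l) =
        2 * V n * (V l / (z n - z l)) - D2 * z n * (V n * (z n * (1 / (z n - z l)) - 1)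
         + z n * (V l / (z n - z l)))"
      by (simp only: diff_divide_distrib times_divide_eq_right)
  qed
  also have "\<dots> = 2 * V n * b V 1
      - D2 * z n * (V n * (z n * b (\<lambda>_. 1) 1 - (of_nat N - 1)) + z n * b V 1)"
    unfolding sum_subtractf sum.distrib sum_distrib_left[symmetric] b_def pole_sum_def
    using card_others[OF assms(2)] by simp
  finally show ?thesis
    unfolding system5_def V lhs sum_pole_pair_vel[OF assms(1,2)] b_def by (simp only:)
qed

lemma system6_iff:
  fixes N n :: nat and \<omega> :: real and z v a :: "nat \<Rightarrow> complex"
  defines "c \<equiv> 2 * (\<i> * of_real \<omega>)"
  defines "V \<equiv> \<lambda>l. v l - c * z l"
    and "b \<equiv> \<lambda>f k. pole_sum (others N n) z f k (z n)"
  shows "system6 N \<omega> A3 F4 z v a n \<longleftrightarrow>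
    a n - (2 * c + \<i> * of_real \<omega>) * v n + c * (c + \<i> * of_real \<omega>) * z n =
      - ((of_nat N - 1) * (2 * A3 + 3 * (of_nat N - 2) * F4) * (z n)^2)
      + (2 * V n * b V 1 + 2 * A3 * (z n)^3 * b (\<lambda>_. 1) 1)
      + 3 * F4 * (z n)^4 * ((b (\<lambda>_. 1) 1)^2 - b (\<lambda>_. 1) 2)"
proof -
  have V: "v l - 2 * \<i> * of_real \<omega> * z l = V l" for l
    by (simp add: V_def c_def)
  have lhs: "a n - 5 * \<i> * of_real \<omega> * v n - 6 * (of_real \<omega>)^2 * z n =
      a n - (2 * c + \<i> * of_real \<omega>) * v n + c * (c + \<i> * of_real \<omega>) * z n"
    by (simp add: c_def algebra_simps power2_eq_square)
  have sums: "(\<Sum>l\<in>others N n. (2 * V n * V l + 2 * A3 * (z n)^3) / (z n - z l)) =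
      2 * V n * b V 1 + 2 * A3 * (z n)^3 * b (\<lambda>_. 1) 1"
    by (simp add: b_def pole_sum_def sum_distrib_left add_divide_distrib sum.distrib mult.assoc)
  show ?thesis
    unfolding system6_def V lhs sums sum_pole_pair b_def ..
qed


section \<open>Linear evolution equations for \<open>\<psi>\<close> and their coefficient
  recursions\<close>

context goldfish_trajectory
begin

lemma E_eq: "E = (\<lambda>t. cis (\<omega> * t))"
  by (simp add: E_def fun_eq_iff)

text \<open>The rank is N - k with natural subtraction, so all indices k >= N have rank 0. There the
  coefficient of \<open>\<psi>''\<close> is 0, and the recursion only has to be checked for k <
  N.\<close>

lemma coeffs_cis_poly_descending:
  assumes step: "\<And>k. k < N \<Longrightarrow> (\<And>j. j > k \<Longrightarrow> cis_poly \<omega> (\<lambda>t. coeff (\<psi> t) j)) \<Longrightarrow>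
                (\<And>j. j > k \<Longrightarrow> cis_poly \<omega> (\<lambda>t. coeff (\<psi>' t) j)) \<Longrightarrow>
                cis_poly \<omega> (\<lambda>t. coeff (\<psi>'' t) k)"
  shows "cis_poly \<omega> (\<lambda>t. coeff (\<psi> t) d)"
proof (rule cis_poly_coeffs[OF _ deriv_psi[unfolded E_eq] deriv_psi'[unfolded E_eq],
      where m = "\<lambda>k. N - k"])
  show "\<omega> \<noteq> 0"
    using omega_pos by simp
  fix k
  assume IH: "\<And>j. N - j < N - k \<Longrightarrow> cis_poly \<omega> (\<lambda>t. coeff (\<psi> t) j)"
    "\<And>j. N - j < N - k \<Longrightarrow> cis_poly \<omega> (\<lambda>t. coeff (\<psi>' t) j)"
  show "cis_poly \<omega> (\<lambda>t. coeff (\<psi>'' t) k)"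
  proof (cases "k < N")
    case True
    then show ?thesis
      by (intro step IH) auto
  qed (simp add: coeff_psi''_high)
qed

lemma coeffs_cis_poly_ascending:
  assumes step: "\<And>k. (\<And>j. j < k \<Longrightarrow> cis_poly \<omega> (\<lambda>t. coeff (\<psi> t) j)) \<Longrightarrow>
                (\<And>j. j < k \<Longrightarrow> cis_poly \<omega> (\<lambda>t. coeff (\<psi>' t) j)) \<Longrightarrow>
                cis_poly \<omega> (\<lambda>t. coeff (\<psi>'' t) k)"
  shows "cis_poly \<omega> (\<lambda>t. coeff (\<psi> t) d)"
proof (rule cis_poly_coeffs[OF _ deriv_psi[unfolded E_eq] deriv_psi'[unfolded E_eq] step,
      where m = "\<lambda>k. k"])
  show "\<omega> \<noteq> 0"
    using omega_pos by simp
qed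

lemmas coeff_simps = coeff_add coeff_diff coeff_smult coeff_pCons_pderiv coeff_pCons2_pderiv2
  coeff_pCons3_pderiv3 coeff_pderiv

text \<open>The evolution equation is psi_tautau + B0 psi_X + F2 X^2 psi_XXX = 0; both couplings
  lower the degree by 1.\<close>

lemma system1_coeffs_cis_poly:
  assumes lam: "lam = - 2"
    and sys: "\<And>n t. n \<in> {1..N} \<Longrightarrow>
      system1 N \<omega> B0 F2 (\<lambda>m. z m t) (\<lambda>m. v m t) (\<lambda>m. a m t) n"
  shows "cis_poly \<omega> (\<lambda>t. coeff (\<psi> t) d)"
proof (rule coeffs_cis_poly_descending)
  have c: "- 2 * (\<i> * of_real \<omega>) = c"
    unfolding c_def by (simp add: lam)
  \<comment> \<open>The constant force \<open>B0\<close> carries no phase, so the phase of the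
    acceleration must be trivial; this forces lam = -2.\<close>
  have sE: "s t * (E t)^2 = 1" for t
    unfolding s_def E_def by (simp add: lam Complex.DeMoivre cis_mult mult.assoc)
  have w: "w n t =
      B0 + 2 * u n t * pole u 1 n t + 3 * F2 * (x n t)^2 * ((pole1 1 n t)^2 - pole1 2 n t)"
    if n: "n \<in> {1..N}" for n t
  proof -
    note eq = sys[OF n, of t, unfolded system1_iff, unfolded c, unfolded pole_sums,
      unfolded a_eq[unfolded c] v_eq, unfolded z_eq[of n t]]
    \<comment> \<open>With the inverse named, cancelling the phases is polynomial algebra modulo
      \<open>sE\<close> and s i = 1.\<close>
    define i where "i = inverse (s t)"
    have i: "s t * i = 1"
      by (simp add: i_def)
    have "s t * (E t)^2 * w n t = s t * (E t)^2 *
       (B0 + 2 * u n t * pole u 1 n t + 3 * F2 * (x n t)^2 * ((pole1 1 n t)^2 - pole1 2 n t))"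
      unfolding eq i_def[symmetric] using sE[of t] i by algebra
    then show ?thesis
      by (simp only: mult_cancel_left) simp
  qed
  \<comment> \<open>At a node this is the equation of motion times q. All terms have degree below N:
    \<open>\<psi>''\<close> because \<open>\<psi>\<close> is monic, the others because the operator
    lowers the degree.\<close>
  have zero: "\<psi>'' t + smult B0 (pderiv (\<psi> t))
      + smult F2 (pCons 0 (pCons 0 (pderiv (pderiv (pderiv (\<psi> t)))))) = 0"
    (is "?R t = 0") for t
  proof (rule poly_eq_0_if_vanishes_on_x)
    fix n assume n: "n \<in> {1..N}"
    show "poly (?R t) (x n t) = 0"
      unfolding poly_add poly_diff poly_smult poly_pCons psi_values[OF n] w[OF n] by algebra
  qed (simp only: coeff_simps, simp add: coeff_psi''_high coeff_psi'_high coeff_psi_high)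
  fix k
  assume IH: "\<And>j. j > k \<Longrightarrow> cis_poly \<omega> (\<lambda>t. coeff (\<psi> t) j)"
  have "coeff (\<psi>'' t) k = - ((B0 * of_nat (Suc k)
      + F2 * (of_nat k * (of_nat k - 1) * of_nat (Suc k))) * coeff (\<psi> t) (Suc k))" for t
    using arg_cong[OF zero[of t], of "\<lambda>p. coeff p k"]
    unfolding coeff_simps eq_neg_iff_add_eq_0
    by (simp add: add_ac mult_ac ring_distribs del: of_nat_Suc)
  then show "cis_poly \<omega> (\<lambda>t. coeff (\<psi>'' t) k)"
    by (simp only:) (intro cis_poly_add cis_poly_minus cis_poly_cmult IH lessI less_SucI)
qed

text \<open>The couplings \<open>A0\<close>, \<open>F1\<close> act on \<open>\<psi>\<close> and
  lower the degree by 2; \<open>D0\<close>, \<open>G1\<close> act on \<open>\<psi>'\<close> and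
  lower it by 1. The one relation s E = 1 serves both kinds, whose phases are 1/s and E.\<close>

lemma system2_coeffs_cis_poly:
  assumes lam: "lam = - 1"
    and sys: "\<And>n t. n \<in> {1..N} \<Longrightarrow>
      system2 N \<omega> A0 D0 F1 G1 (\<lambda>m. z m t) (\<lambda>m. v m t) (\<lambda>m. a m t) n"
  shows "cis_poly \<omega> (\<lambda>t. coeff (\<psi> t) d)"
proof (rule coeffs_cis_poly_descending)
  have c: "- (\<i> * of_real \<omega>) = c"
    unfolding c_def by (simp add: lam)
  have sE: "s t * E t = 1" for t
    unfolding s_def E_def by (simp add: lam Complex.DeMoivre cis_mult mult.assoc)
  have w: "w n t =
      2 * u n t * pole u 1 n t + 2 * A0 * pole1 1 n t
      - D0 * (u n t * pole1 1 n t + pole u 1 n t) + 3 * F1 * x n t * ((pole1 1 n t)^2 - pole1 2 n t)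
      - G1 * x n t * (u n t * ((pole1 1 n t)^2 - pole1 2 n t)
        + 2 * (pole u 1 n t * pole1 1 n t - pole u 2 n t))"
    if n: "n \<in> {1..N}" for n t
  proof -
    note eq = sys[OF n, of t, unfolded system2_iff[OF inj_z n], unfolded c, unfolded pole_sums,
      unfolded a_eq[unfolded c] v_eq, unfolded z_eq[of n t]]
    define i where "i = inverse (s t)"
    have i: "s t * i = 1"
      by (simp add: i_def)
    have "s t * (E t)^2 * w n t = s t * (E t)^2 *
       (2 * u n t * pole u 1 n t + 2 * A0 * pole1 1 n t
      - D0 * (u n t * pole1 1 n t + pole u 1 n t) + 3 * F1 * x n t * ((pole1 1 n t)^2 - pole1 2 n t)
      - G1 * x n t * (u n t * ((pole1 1 n t)^2 - pole1 2 n t)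
        + 2 * (pole u 1 n t * pole1 1 n t - pole u 2 n t)))"
      unfolding eq i_def[symmetric] using sE[of t] i by algebra
    then show ?thesis
      by (simp only: mult_cancel_left) simp
  qed
  have zero: "\<psi>'' t + smult A0 (pderiv (pderiv (\<psi> t))) + smult D0 (pderiv (\<psi>' t))
      + smult F1 (pCons 0 (pderiv (pderiv (pderiv (\<psi> t)))))
      + smult G1 (pCons 0 (pderiv (pderiv (\<psi>' t)))) = 0"
    (is "?R t = 0") for t
  proof (rule poly_eq_0_if_vanishes_on_x)
    fix n assume n: "n \<in> {1..N}"
    show "poly (?R t) (x n t) = 0"
      unfolding poly_add poly_diff poly_smult poly_pCons psi_values[OF n] w[OF n] by algebra
  qed (simp only: coeff_simps, simp add: coeff_psi''_high coeff_psi'_high coeff_psi_high)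
  fix k
  assume IH: "\<And>j. j > k \<Longrightarrow> cis_poly \<omega> (\<lambda>t. coeff (\<psi> t) j)"
    "\<And>j. j > k \<Longrightarrow> cis_poly \<omega> (\<lambda>t. coeff (\<psi>' t) j)"
  have "coeff (\<psi>'' t) k = - ((A0 + F1 * of_nat k) * (of_nat (Suc k) * of_nat (Suc (Suc k)))
        * coeff (\<psi> t) (Suc (Suc k))
      + (D0 + G1 * of_nat k) * of_nat (Suc k) * coeff (\<psi>' t) (Suc k))" for t
    using arg_cong[OF zero[of t], of "\<lambda>p. coeff p k"]
    unfolding coeff_simps eq_neg_iff_add_eq_0
    by (simp add: add_ac mult_ac ring_distribs del: of_nat_Suc)
  then show "cis_poly \<omega> (\<lambda>t. coeff (\<psi>'' t) k)"
    by (simp only:) (intro cis_poly_add cis_poly_minus cis_poly_cmult IH lessI less_SucI)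
qed

text \<open>The equation is psi_tautau + F0 psi_XXX = 0. The force scales as 1/s^2, whence s^3 E^2 =
  1.\<close>

lemma system3_coeffs_cis_poly:
  assumes lam: "lam = - (2 / 3)"
    and sys: "\<And>n t. n \<in> {1..N} \<Longrightarrow>
      system3 N \<omega> F0 (\<lambda>m. z m t) (\<lambda>m. v m t) (\<lambda>m. a m t) n"
  shows "cis_poly \<omega> (\<lambda>t. coeff (\<psi> t) d)"
proof (rule coeffs_cis_poly_descending)
  have c: "- (2 / 3) * (\<i> * of_real \<omega>) = c"
    unfolding c_def by (simp add: lam)
  have sE: "(s t)^3 * (E t)^2 = 1" for t
    unfolding s_def E_def by (simp add: lam Complex.DeMoivre cis_mult mult.assoc)
  have w: "w n t =
      2 * u n t * pole u 1 n t + 3 * F0 * ((pole1 1 n t)^2 - pole1 2 n t)"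
    if n: "n \<in> {1..N}" for n t
  proof -
    note eq = sys[OF n, of t, unfolded system3_iff, unfolded c, unfolded pole_sums,
      unfolded a_eq[unfolded c] v_eq, unfolded z_eq[of n t]]
    define i where "i = inverse (s t)"
    have i: "s t * i = 1"
      by (simp add: i_def)
    have "s t * (E t)^2 * w n t = s t * (E t)^2 *
       (2 * u n t * pole u 1 n t + 3 * F0 * ((pole1 1 n t)^2 - pole1 2 n t))"
      unfolding eq i_def[symmetric] using sE[of t] i by algebra
    then show ?thesis
      by (simp only: mult_cancel_left) simp
  qed
  have zero: "\<psi>'' t + smult F0 (pderiv (pderiv (pderiv (\<psi> t)))) = 0"
    (is "?R t = 0") for t
  proof (rule poly_eq_0_if_vanishes_on_x)
    fix n assume n: "n \<in> {1..N}"
    show "poly (?R t) (x n t) = 0"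
      unfolding poly_add poly_diff poly_smult poly_pCons psi_values[OF n] w[OF n] by algebra
  qed (simp only: coeff_simps, simp add: coeff_psi''_high coeff_psi'_high coeff_psi_high)
  fix k
  assume IH: "\<And>j. j > k \<Longrightarrow> cis_poly \<omega> (\<lambda>t. coeff (\<psi> t) j)"
  have "coeff (\<psi>'' t) k = - ((F0 * (of_nat (Suc k) * of_nat (Suc (Suc k)) * of_nat (Suc (Suc (Suc k)))))
      * coeff (\<psi> t) (Suc (Suc (Suc k))))" for t
    using arg_cong[OF zero[of t], of "\<lambda>p. coeff p k"]
    unfolding coeff_simps eq_neg_iff_add_eq_0
    by (simp add: add_ac mult_ac ring_distribs del: of_nat_Suc)
  then show "cis_poly \<omega> (\<lambda>t. coeff (\<psi>'' t) k)"
    by (simp only:) (intro cis_poly_add cis_poly_minus cis_poly_cmult IH lessI less_SucI)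
qed

text \<open>The equation is psi_tautau + G0 psi_XXtau = 0. The force scales as E/s, whence s^2 E =
  1.\<close>

lemma system4_coeffs_cis_poly:
  assumes lam: "lam = - (1 / 2)"
    and sys: "\<And>n t. n \<in> {1..N} \<Longrightarrow>
      system4 N \<omega> G0 (\<lambda>m. z m t) (\<lambda>m. v m t) (\<lambda>m. a m t) n"
  shows "cis_poly \<omega> (\<lambda>t. coeff (\<psi> t) d)"
proof (rule coeffs_cis_poly_descending)
  have c: "- (1 / 2) * (\<i> * of_real \<omega>) = c"
    unfolding c_def by (simp add: lam)
  have sE: "(s t)^2 * E t = 1" for t
    unfolding s_def E_def by (simp add: lam Complex.DeMoivre cis_mult mult.assoc)
  have w: "w n t =
      2 * u n t * pole u 1 n t - G0 * (u n t * ((pole1 1 n t)^2 - pole1 2 n t)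
        + 2 * (pole u 1 n t * pole1 1 n t - pole u 2 n t))"
    if n: "n \<in> {1..N}" for n t
  proof -
    note eq = sys[OF n, of t, unfolded system4_iff[OF inj_z n], unfolded c, unfolded pole_sums,
      unfolded a_eq[unfolded c] v_eq, unfolded z_eq[of n t]]
    define i where "i = inverse (s t)"
    have i: "s t * i = 1"
      by (simp add: i_def)
    have "s t * (E t)^2 * w n t = s t * (E t)^2 *
       (2 * u n t * pole u 1 n t - G0 * (u n t * ((pole1 1 n t)^2 - pole1 2 n t)
        + 2 * (pole u 1 n t * pole1 1 n t - pole u 2 n t)))"
      unfolding eq i_def[symmetric] using sE[of t] i by algebra
    then show ?thesis
      by (simp only: mult_cancel_left) simp
  qed
  have zero: "\<psi>'' t + smult G0 (pderiv (pderiv (\<psi>' t))) = 0"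
    (is "?R t = 0") for t
  proof (rule poly_eq_0_if_vanishes_on_x)
    fix n assume n: "n \<in> {1..N}"
    show "poly (?R t) (x n t) = 0"
      unfolding poly_add poly_diff poly_smult poly_pCons psi_values[OF n] w[OF n] by algebra
  qed (simp only: coeff_simps, simp add: coeff_psi''_high coeff_psi'_high coeff_psi_high)
  fix k
  assume IH: "\<And>j. j > k \<Longrightarrow> cis_poly \<omega> (\<lambda>t. coeff (\<psi>' t) j)"
  have "coeff (\<psi>'' t) k = - ((G0 * (of_nat (Suc k) * of_nat (Suc (Suc k)))) * coeff (\<psi>' t) (Suc (Suc k)))" for t
    using arg_cong[OF zero[of t], of "\<lambda>p. coeff p k"]
    unfolding coeff_simps eq_neg_iff_add_eq_0
    by (simp add: add_ac mult_ac ring_distribs del: of_nat_Suc)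
  then show "cis_poly \<omega> (\<lambda>t. coeff (\<psi>'' t) k)"
    by (simp only:) (intro cis_poly_add cis_poly_minus cis_poly_cmult IH lessI less_SucI)
qed

lemma system5_coeffs_cis_poly:
  assumes lam: "lam = 1"
    and sys: "\<And>n t. n \<in> {1..N} \<Longrightarrow>
      system5 N \<omega> D2 G3 (\<lambda>m. z m t) (\<lambda>m. v m t) (\<lambda>m. a m t) n"
  shows "cis_poly \<omega> (\<lambda>t. coeff (\<psi> t) d)"
proof (rule coeffs_cis_poly_ascending)
  have c: "\<i> * of_real \<omega> = c"
    unfolding c_def by (simp add: lam)
  have sE: "s t = E t" for t
    unfolding s_def E_def by (simp add: lam Complex.DeMoivre cis_mult mult.assoc)
  have w: "w n t =
      (of_nat N - 1) * (of_nat N - 2) * G3 * u n t * x n t + 2 * u n t * pole u 1 n t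
      - D2 * x n t * (u n t * (x n t * pole1 1 n t - (of_nat N - 1)) + x n t * pole u 1 n t)
      - G3 * (x n t)^3 * (u n t * ((pole1 1 n t)^2 - pole1 2 n t)
        + 2 * (pole u 1 n t * pole1 1 n t - pole u 2 n t))"
    if n: "n \<in> {1..N}" for n t
  proof -
    note eq = sys[OF n, of t, unfolded system5_iff[OF inj_z n], unfolded c, unfolded pole_sums,
      unfolded a_eq[unfolded c] v_eq, unfolded z_eq[of n t]]
    define i where "i = inverse (s t)"
    have i: "s t * i = 1"
      by (simp add: i_def)
    have "s t * (E t)^2 * w n t = s t * (E t)^2 *
       ((of_nat N - 1) * (of_nat N - 2) * G3 * u n t * x n t + 2 * u n t * pole u 1 n t
      - D2 * x n t * (u n t * (x n t * pole1 1 n t - (of_nat N - 1)) + x n t * pole u 1 n t)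
      - G3 * (x n t)^3 * (u n t * ((pole1 1 n t)^2 - pole1 2 n t)
        + 2 * (pole u 1 n t * pole1 1 n t - pole u 2 n t)))"
      unfolding eq i_def[symmetric] using i unfolding sE by algebra
    then show ?thesis
      by (simp only: mult_cancel_left) simp
  qed
  \<comment> \<open>The operators raise the degree by 1, and \<open>\<psi>'\<close> has degree at
    most N - 1. Subtracting the eigenvalues N - 1 and (N - 1)(N - 2) of the Euler operators on
    X^(N-1) prevents a term X^N. These corrections do not vanish at the nodes: they reproduce the
    N-dependent terms of \<open>w\<close>.\<close>
  have zero: "\<psi>'' t + smult D2 (pCons 0 ((pCons 0 (pderiv (\<psi>' t))) - smult (of_nat N - 1) (\<psi>' t)))
      + smult G3 (pCons 0 ((pCons 0 (pCons 0 (pderiv (pderiv (\<psi>' t)))))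
        - smult ((of_nat N - 1) * (of_nat N - 2)) (\<psi>' t))) = 0"
    (is "?R t = 0") for t
  proof (rule poly_eq_0_if_vanishes_on_x)
    fix n assume n: "n \<in> {1..N}"
    show "poly (?R t) (x n t) = 0"
      unfolding poly_add poly_diff poly_smult poly_pCons psi_values[OF n] w[OF n] by algebra
  next
    fix k assume "k \<ge> N"
    with N_pos obtain j where j: "k = Suc j" "j \<ge> N - 1"
      by (cases k) auto
    consider "j = N - 1" | "j \<ge> N"
      using j by linarith
    then show "coeff (?R t) k = 0"
    proof cases
      \<comment> \<open>The borderline degree: the coefficient of \<open>\<psi>'\<close> may be
        nonzero, but its multiplier vanishes at j = N - 1.\<close>
      case 1
      with N_pos have "of_nat N = (of_nat j + 1 :: complex)"
        by (auto simp: of_nat_diff)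
      with j show ?thesis
        unfolding j coeff_add coeff_smult coeff_pCons_Suc coeff_diff
        by (simp add: coeff_simps coeff_psi''_high coeff_psi'_high algebra_simps)
    next
      case 2
      then show ?thesis
        unfolding j coeff_add coeff_smult coeff_pCons_Suc coeff_diff
        by (cases "j = N") (simp_all add: coeff_simps coeff_psi''_high coeff_psi'_high
            coeff_psi_high coeff_psi_N algebra_simps)
    qed
  qed
  fix k
  assume IH: "\<And>j. j < k \<Longrightarrow> cis_poly \<omega> (\<lambda>t. coeff (\<psi>' t) j)"
  show "cis_poly \<omega> (\<lambda>t. coeff (\<psi>'' t) k)"
  proof (cases k)
    \<comment> \<open>Every coupling term has a factor X, so the recursion starts from a vanishing
      second derivative.\<close>
    case 0
    have "coeff (\<psi>'' t) 0 = 0" for t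
      using arg_cong[OF zero[of t], of "\<lambda>p. coeff p 0"] by simp
    then show ?thesis
      by (simp add: 0)
  next
    case (Suc j)
    have "coeff (\<psi>'' t) (Suc j) = - ((D2 * (of_nat j - (of_nat N - 1))
        + G3 * (of_nat j * (of_nat j - 1) - (of_nat N - 1) * (of_nat N - 2))) * coeff (\<psi>' t) j)" for t
      using arg_cong[OF zero[of t], of "\<lambda>p. coeff p (Suc j)"]
      unfolding coeff_add coeff_smult coeff_pCons_Suc coeff_diff
      by (simp add: coeff_simps eq_neg_iff_add_eq_0 algebra_simps)
    then show ?thesis
      unfolding Suc by (simp only:) (intro cis_poly_minus cis_poly_cmult IH; simp add: Suc)
  qed
qed

text \<open>The multiples of \<open>\<psi>\<close> added in \<open>zero\<close> vanish at the nodes; they make the two linear operators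
  annihilate \<open>X^N\<close> and \<open>X^(N-1)\<close>, so that the left-hand side has degree below \<open>N\<close>.\<close>

lemma system6_coeffs_cis_poly:
  assumes lam: "lam = 2"
    and sys: "\<And>n t. n \<in> {1..N} \<Longrightarrow>
      system6 N \<omega> A3 F4 (\<lambda>m. z m t) (\<lambda>m. v m t) (\<lambda>m. a m t) n"
  shows "cis_poly \<omega> (\<lambda>t. coeff (\<psi> t) d)"
proof (rule coeffs_cis_poly_ascending)
  have c: "2 * (\<i> * of_real \<omega>) = c"
    unfolding c_def by (simp add: lam)
  have sE: "s t = (E t)^2" for t
    unfolding s_def E_def by (simp add: lam Complex.DeMoivre cis_mult mult.assoc)
  have w: "w n t =
      - ((of_nat N - 1) * (2 * A3 + 3 * (of_nat N - 2) * F4) * (x n t)^2)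
      + 2 * u n t * pole u 1 n t + 2 * A3 * (x n t)^3 * pole1 1 n t
      + 3 * F4 * (x n t)^4 * ((pole1 1 n t)^2 - pole1 2 n t)"
    if n: "n \<in> {1..N}" for n t
  proof -
    note eq = sys[OF n, of t, unfolded system6_iff, unfolded c, unfolded pole_sums,
      unfolded a_eq[unfolded c] v_eq, unfolded z_eq[of n t]]
    define i where "i = inverse (s t)"
    have i: "s t * i = 1"
      by (simp add: i_def)
    have "s t * (E t)^2 * w n t = s t * (E t)^2 *
       (- ((of_nat N - 1) * (2 * A3 + 3 * (of_nat N - 2) * F4) * (x n t)^2)
      + 2 * u n t * pole u 1 n t + 2 * A3 * (x n t)^3 * pole1 1 n t
      + 3 * F4 * (x n t)^4 * ((pole1 1 n t)^2 - pole1 2 n t))"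
      unfolding eq i_def[symmetric] using sE[of t] i by algebra
    then show ?thesis
      by (simp only: mult_cancel_left) simp
  qed
  \<comment> \<open>On X^j the two inner operators have the eigenvalues (j - N)(j - N + 1) and (j -
    N)(j - N + 1)(j + 2N - 4). The parts with \<open>pderiv\<close> to first order account for the
    explicit \<open>(z n)^2\<close> force.\<close>
  have zero: "\<psi>'' t
      + smult A3 (pCons 0 ((pCons 0 (pCons 0 (pderiv (pderiv (\<psi> t))))) - smult (2 * (of_nat N - 1)) (pCons 0 (pderiv (\<psi> t)))
          + smult (of_nat N * (of_nat N - 1)) (\<psi> t)))
      + smult F4 (pCons 0 ((pCons 0 (pCons 0 (pCons 0 (pderiv (pderiv (pderiv (\<psi> t)))))))
          - smult (3 * (of_nat N - 1) * (of_nat N - 2)) (pCons 0 (pderiv (\<psi> t)))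
          + smult (2 * of_nat N * (of_nat N - 1) * (of_nat N - 2)) (\<psi> t))) = 0"
    (is "?R t = 0") for t
  proof (rule poly_eq_0_if_vanishes_on_x)
    fix n assume n: "n \<in> {1..N}"
    show "poly (?R t) (x n t) = 0"
      unfolding poly_add poly_diff poly_smult poly_pCons psi_values[OF n] w[OF n] by algebra
  next
    fix k assume "k \<ge> N"
    with N_pos obtain j where j: "k = Suc j" "j \<ge> N - 1"
      by (cases k) auto
    consider "j = N - 1" | "j \<ge> N"
      using j by linarith
    then show "coeff (?R t) k = 0"
    proof cases
      case 1
      with N_pos have "of_nat N = (of_nat j + 1 :: complex)"
        by (auto simp: of_nat_diff)
      with j show ?thesis
        unfolding j coeff_add coeff_smult coeff_pCons_Suc coeff_diff
        by (simp add: coeff_simps coeff_psi''_high coeff_psi_high algebra_simps)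
    next
      \<comment> \<open>At j = N the coefficient of \<open>\<psi>\<close> is 1 and the eigenvalues
        are 0; beyond N the coefficients of \<open>\<psi>\<close> are 0.\<close>
      case 2
      then show ?thesis
        unfolding j coeff_add coeff_smult coeff_pCons_Suc coeff_diff
        by (cases "j = N") (simp_all add: coeff_simps coeff_psi''_high coeff_psi'_high
            coeff_psi_high coeff_psi_N algebra_simps)
    qed
  qed
  fix k
  assume IH: "\<And>j. j < k \<Longrightarrow> cis_poly \<omega> (\<lambda>t. coeff (\<psi> t) j)"
  show "cis_poly \<omega> (\<lambda>t. coeff (\<psi>'' t) k)"
  proof (cases k)
    case 0
    have "coeff (\<psi>'' t) 0 = 0" for t
      using arg_cong[OF zero[of t], of "\<lambda>p. coeff p 0"] by simp
    then show ?thesis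
      by (simp add: 0)
  next
    case (Suc j)
    have "coeff (\<psi>'' t) (Suc j) = - ((A3 * (of_nat j * (of_nat j - 1) - 2 * (of_nat N - 1) * of_nat j
          + of_nat N * (of_nat N - 1))
        + F4 * (of_nat j * (of_nat j - 1) * (of_nat j - 2)
            - 3 * (of_nat N - 1) * (of_nat N - 2) * of_nat j
            + 2 * of_nat N * (of_nat N - 1) * (of_nat N - 2))) * coeff (\<psi> t) j)" for t
      using arg_cong[OF zero[of t], of "\<lambda>p. coeff p (Suc j)"]
      unfolding coeff_add coeff_smult coeff_pCons_Suc coeff_diff
      by (simp add: coeff_simps eq_neg_iff_add_eq_0 algebra_simps)
    then show ?thesis
      unfolding Suc by (simp only:) (intro cis_poly_minus cis_poly_cmult IH; simp add: Suc)
  qed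
qed

end

theorem mainTheorem6:
  fixes N :: nat and \<omega> :: real
    and A0 A3 B0 D0 D2 F0 F1 F2 F4 G0 G1 G3 :: complex
  assumes "N \<ge> 2" and "\<omega> > 0"
  shows "isochronous N \<omega> (system1 N \<omega> B0 F2)
       \<and> isochronous N \<omega> (system2 N \<omega> A0 D0 F1 G1)
       \<and> isochronous N \<omega> (system3 N \<omega> F0)
       \<and> isochronous N \<omega> (system4 N \<omega> G0)
       \<and> isochronous N \<omega> (system5 N \<omega> D2 G3)
       \<and> isochronous N \<omega> (system6 N \<omega> A3 F4)"
proof -
  have I: "isochronous N \<omega> S"
    if lam: "6 * lam \<in> \<int>"
      and coeffs: "\<And>z v a d. goldfish_trajectory N \<omega> z v a \<Longrightarrow>
        (\<And>n t. n \<in> {1..N} \<Longrightarrow> S (\<lambda>m. z m t) (\<lambda>m. v m t) (\<lambda>m. a m t) n) \<Longrightarrow>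
        cis_poly \<omega> (\<lambda>t. coeff (goldfish_trajectory.\<psi> N \<omega> lam z t) d)"
    for lam S
    unfolding isochronous_def
  proof (intro exI[of _ "fact N * 6"] conjI allI impI ballI)
    fix z t n
    assume "global_solution N S z" and n: "n \<in> {1..N}"
    then obtain v a where va: "\<forall>t. inj_on (\<lambda>n. z n t) {1..N} \<and>
        (\<forall>n\<in>{1..N}. (z n has_vector_derivative v n t) (at t) \<and>
          (v n has_vector_derivative a n t) (at t) \<and>
          S (\<lambda>m. z m t) (\<lambda>m. v m t) (\<lambda>m. a m t) n)"
      unfolding global_solution_def by (elim exE)
    interpret goldfish_trajectory N \<omega> lam z v a
      by standard (use assms lam va in auto)
    define T where "T = 2 * pi * real 6 / \<omega>"
    have "S (\<lambda>m. z m t) (\<lambda>m. v m t) (\<lambda>m. a m t) n" if "n \<in> {1..N}" for n t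
      using va that by blast
    from coeffs[OF goldfish_trajectory_axioms this]
    have psi: "\<psi> (t + T) = \<psi> t" for t
      unfolding T_def by (intro poly_eqI cis_poly_periodic[of \<omega>] omega_pos)
    have "lam * \<omega> * (t + T) = lam * \<omega> * t + 2 * pi * (6 * lam)" for t
      unfolding T_def using omega_pos by (simp add: field_simps)
    then have "s (t + T) = s t * cis (2 * pi * (6 * lam))" for t
      unfolding s_def by (simp only: cis_mult)
    then have s: "s (t + T) = s t" for t
      using cis_multiple_2pi[OF lam] by (simp only: mult_1_right)
    \<comment> \<open>Both \<open>\<psi>\<close> and the phase \<open>s\<close> return after T, so
      \<open>x n (t + T)\<close> is a root of \<open>\<psi> t\<close>, hence one of the
      \<open>x m t\<close>, and multiplying by the same phase gives \<open>z m t\<close>.\<close>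
    have perm: "\<exists>m\<in>{1..N}. z n (t + T) = z m t" if "n \<in> {1..N}" for n t
    proof -
      have "poly (\<psi> t) (x n (t + T)) = 0"
        using psi_values(1)[OF that, of "t + T"] psi by simp
      then obtain m where "m \<in> {1..N}" "x n (t + T) = x m t"
        by (auto simp: \<psi>_def root_poly_def poly_prod)
      then show ?thesis
        by (auto simp: z_eq[of n "t + T"] z_eq[of _ t] s)
    qed
    have "continuous_on UNIV (z n)" if "n \<in> {1..N}" for n
      by (intro continuous_at_imp_continuous_on ballI)
         (rule has_vector_derivative_continuous[OF deriv_z[OF that]])
    from periodic_if_permuted[OF this inj_z perm n]
    have "z n (t + real (fact N) * T) = z n t" .
    moreover have "real (fact N) * T = 2 * pi * real (fact N * 6) / \<omega>"
      by (simp add: T_def)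
    ultimately show "z n (t + 2 * pi * real (fact N * 6) / \<omega>) = z n t"
      by simp
  qed simp
  show ?thesis
  proof (intro conjI)
    show "isochronous N \<omega> (system1 N \<omega> B0 F2)"
    proof (rule I[where lam = "- 2"])
      fix z v a d
      assume A: "goldfish_trajectory N \<omega> z v a"
        "\<And>n t. n \<in> {1..N} \<Longrightarrow>
          system1 N \<omega> B0 F2 (\<lambda>m. z m t) (\<lambda>m. v m t) (\<lambda>m. a m t) n"
      show "cis_poly \<omega> (\<lambda>t. coeff (goldfish_trajectory.\<psi> N \<omega> (- 2) z t) d)"
        by (rule goldfish_trajectory.system1_coeffs_cis_poly[OF A(1) refl A(2)])
    qed simp
    show "isochronous N \<omega> (system2 N \<omega> A0 D0 F1 G1)"
    proof (rule I[where lam = "- 1"])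
      fix z v a d
      assume A: "goldfish_trajectory N \<omega> z v a"
        "\<And>n t. n \<in> {1..N} \<Longrightarrow>
          system2 N \<omega> A0 D0 F1 G1 (\<lambda>m. z m t) (\<lambda>m. v m t) (\<lambda>m. a m t) n"
      show "cis_poly \<omega> (\<lambda>t. coeff (goldfish_trajectory.\<psi> N \<omega> (- 1) z t) d)"
        by (rule goldfish_trajectory.system2_coeffs_cis_poly[OF A(1) refl A(2)])
    qed simp
    show "isochronous N \<omega> (system3 N \<omega> F0)"
    proof (rule I[where lam = "- (2 / 3)"])
      fix z v a d
      assume A: "goldfish_trajectory N \<omega> z v a"
        "\<And>n t. n \<in> {1..N} \<Longrightarrow>
          system3 N \<omega> F0 (\<lambda>m. z m t) (\<lambda>m. v m t) (\<lambda>m. a m t) n"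
      show "cis_poly \<omega> (\<lambda>t. coeff (goldfish_trajectory.\<psi> N \<omega> (- (2 / 3)) z t) d)"
        by (rule goldfish_trajectory.system3_coeffs_cis_poly[OF A(1) refl A(2)])
    qed simp
    show "isochronous N \<omega> (system4 N \<omega> G0)"
    proof (rule I[where lam = "- (1 / 2)"])
      fix z v a d
      assume A: "goldfish_trajectory N \<omega> z v a"
        "\<And>n t. n \<in> {1..N} \<Longrightarrow>
          system4 N \<omega> G0 (\<lambda>m. z m t) (\<lambda>m. v m t) (\<lambda>m. a m t) n"
      show "cis_poly \<omega> (\<lambda>t. coeff (goldfish_trajectory.\<psi> N \<omega> (- (1 / 2)) z t) d)"
        by (rule goldfish_trajectory.system4_coeffs_cis_poly[OF A(1) refl A(2)])
    qed simp
    show "isochronous N \<omega> (system5 N \<omega> D2 G3)"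
    proof (rule I[where lam = "1"])
      fix z v a d
      assume A: "goldfish_trajectory N \<omega> z v a"
        "\<And>n t. n \<in> {1..N} \<Longrightarrow>
          system5 N \<omega> D2 G3 (\<lambda>m. z m t) (\<lambda>m. v m t) (\<lambda>m. a m t) n"
      show "cis_poly \<omega> (\<lambda>t. coeff (goldfish_trajectory.\<psi> N \<omega> (1) z t) d)"
        by (rule goldfish_trajectory.system5_coeffs_cis_poly[OF A(1) refl A(2)])
    qed simp
    show "isochronous N \<omega> (system6 N \<omega> A3 F4)"
    proof (rule I[where lam = "2"])
      fix z v a d
      assume A: "goldfish_trajectory N \<omega> z v a"
        "\<And>n t. n \<in> {1..N} \<Longrightarrow>
          system6 N \<omega> A3 F4 (\<lambda>m. z m t) (\<lambda>m. v m t) (\<lambda>m. a m t) n"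
      show "cis_poly \<omega> (\<lambda>t. coeff (goldfish_trajectory.\<psi> N \<omega> (2) z t) d)"
        by (rule goldfish_trajectory.system6_coeffs_cis_poly[OF A(1) refl A(2)])
    qed simp
  qed
qed

end
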